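(* Let $(M^n,g)$ be a Riemannian manifold carrying a conformal product structure with adapted Weyl connection $D$, Lee form $\theta$, and orthogonal $D$-parallel splitting $TM=T_1\oplus T_2$, with $p=\operatorname{rank}T_1\ge2$ and $q=\operatorname{rank}T_2\ge2$. Then $$D\text{ is closed}\iff d\theta=0\iff[\mathcal K_W,S]=0.$$ Equivalently, $D$ is closed exactly when $\mathcal K_W$ preserves $T_1$ and $T_2$.
   Context: Let $\nabla$ be the Levi-Civita connection of $g$. A Weyl connection on $(M,g)$ is a connection of the form $D_XY=\nabla_XY+\theta(Y)X+\theta(X)Y-g(X,Y)\theta^\sharp$ for a one-form $\theta$, called its Lee form; $D$ is called closed if $d\theta=0$. A conformal product structure on $(M,g)$ is a $g$-orthogonal splitting $TM=T_1\oplus T_2$ into distributions of constant rank together with a Weyl connection $D$ (the adapted Weyl connection) preserving both $T_1$ and $T_2$. $S$ is the orthogonal involution with $S|_{T_1}=\mathrm{Id}$, $S|_{T_2}=-\mathrm{Id}$. $W$ is the Weyl tensor of $g$ (totally trace-free part of the curvature $R(X,Y)Z=\nabla_X\nabla_YZ-\nabla_Y\nabla_XZ-\nabla_{[X,Y]}Z$), written $W_{X,Y}Z$, and $\mathcal K_W(X)=\sum_i W_{X,e_i}(Se_i)$ for any local orthonormal frame $\{e_i\}$ of $TM$. $[A,B]=AB-BA$. *)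

theory Defs
  imports "HOL-Analysis.Analysis"
begin

text \<open>
  Geometric objects on a manifold are given by their local representatives: one for each chart of
  a fixed smooth atlas, defined on the image of the chart, and related by the
  transformation law of the object on overlaps. The values of a representative outside the image
  of its chart are irrelevant. The model space \<open>'v\<close> is an arbitrary Euclidean space and the
  dimension of the manifold is \<open>DIM('v)\<close>; no geometric notion below uses the inner product of \<open>'v\<close>.
\<close>

abbreviation dderiv :: "('v::real_normed_vector \<Rightarrow> 'w::real_normed_vector) \<Rightarrow> 'v \<Rightarrow> 'v \<Rightarrow> 'w" where
  "dderiv f u v \<equiv> frechet_derivative f (at u) v"

primrec Ck_on :: "nat \<Rightarrow> 'v::real_normed_vector set \<Rightarrow> ('v \<Rightarrow> 'w::real_normed_vector) \<Rightarrow> bool" where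
  "Ck_on 0 N f \<longleftrightarrow> continuous_on N f"
| "Ck_on (Suc k) N f \<longleftrightarrow> f differentiable_on N \<and> (\<forall>v. Ck_on k N (\<lambda>u. dderiv f u v))"

text \<open>Only meaningful for open \<open>N\<close>, because two-sided derivatives are used.\<close>

definition smooth_on :: "'v::real_normed_vector set \<Rightarrow> ('v \<Rightarrow> 'w::real_normed_vector) \<Rightarrow> bool" where
  "smooth_on N f \<longleftrightarrow> (\<forall>k. Ck_on k N f)"

definition lie_bracket ::
    "('v::real_normed_vector \<Rightarrow> 'v) \<Rightarrow> ('v \<Rightarrow> 'v) \<Rightarrow> 'v \<Rightarrow> 'v" where
  "lie_bracket X Y u = dderiv Y u (X u) - dderiv X u (Y u)"

type_synonym ('a, 'v) chart = "'a set \<times> ('a \<Rightarrow> 'v)"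

abbreviation chart_image :: "('a, 'v) chart \<Rightarrow> 'v set" where
  "chart_image c \<equiv> snd c ` fst c"

definition transition :: "('a, 'v) chart \<Rightarrow> ('a, 'v) chart \<Rightarrow> 'v \<Rightarrow> 'v" where
  "transition c d = snd d \<circ> inv_into (fst c) (snd c)"

abbreviation overlap :: "('a, 'v) chart \<Rightarrow> ('a, 'v) chart \<Rightarrow> 'v set" where
  "overlap c d \<equiv> snd c ` (fst c \<inter> fst d)"

definition chart_on :: "'a topology \<Rightarrow> ('a, 'v::euclidean_space) chart \<Rightarrow> bool" where
  "chart_on M c \<longleftrightarrow> openin M (fst c) \<and> open (chart_image c) \<and>
     homeomorphic_map (subtopology M (fst c)) (top_of_set (chart_image c)) (snd c)"

definition smooth_manifold :: "'a topology \<Rightarrow> ('a, 'v::euclidean_space) chart set \<Rightarrow> bool" where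
  "smooth_manifold M A \<longleftrightarrow>
     Hausdorff_space M \<and> second_countable M \<and>
     (\<forall>c\<in>A. chart_on M c) \<and> (\<Union>c\<in>A. fst c) = topspace M \<and>
     (\<forall>c\<in>A. \<forall>d\<in>A. smooth_on (overlap c d) (transition c d))"

type_synonym ('a, 'v) metric = "('a, 'v) chart \<Rightarrow> 'v \<Rightarrow> 'v \<Rightarrow> 'v \<Rightarrow> real"
type_synonym ('a, 'v) oneform = "('a, 'v) chart \<Rightarrow> 'v \<Rightarrow> 'v \<Rightarrow> real"
type_synonym ('a, 'v) dist = "('a, 'v) chart \<Rightarrow> 'v \<Rightarrow> 'v set"
type_synonym ('a, 'v) endo = "('a, 'v) chart \<Rightarrow> 'v \<Rightarrow> 'v \<Rightarrow> 'v"

definition riemannian_metric ::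
    "('a, 'v::euclidean_space) chart set \<Rightarrow> ('a, 'v) metric \<Rightarrow> bool" where
  "riemannian_metric A g \<longleftrightarrow>
     (\<forall>c\<in>A. \<forall>u\<in>chart_image c. bilinear (g c u) \<and>
        (\<forall>v w. g c u v w = g c u w v) \<and> (\<forall>v. v \<noteq> 0 \<longrightarrow> g c u v v > 0)) \<and>
     (\<forall>c\<in>A. \<forall>v w. smooth_on (chart_image c) (\<lambda>u. g c u v w)) \<and>
     (\<forall>c\<in>A. \<forall>d\<in>A. \<forall>u\<in>overlap c d. \<forall>v w. let \<tau> = transition c d in
        g c u v w = g d (\<tau> u) (dderiv \<tau> u v) (dderiv \<tau> u w))"

definition one_form ::
    "('a, 'v::euclidean_space) chart set \<Rightarrow> ('a, 'v) oneform \<Rightarrow> bool" where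
  "one_form A \<theta> \<longleftrightarrow>
     (\<forall>c\<in>A. \<forall>u\<in>chart_image c. linear (\<theta> c u)) \<and>
     (\<forall>c\<in>A. \<forall>v. smooth_on (chart_image c) (\<lambda>u. \<theta> c u v)) \<and>
     (\<forall>c\<in>A. \<forall>d\<in>A. \<forall>u\<in>overlap c d. \<forall>v. let \<tau> = transition c d in
        \<theta> c u v = \<theta> d (\<tau> u) (dderiv \<tau> u v))"

text \<open>
  The formula \<open>d\<theta>(V,W) = V(\<theta>(W)) - W(\<theta>(V)) - \<theta>([V,W])\<close> for constant (hence commuting) local
  fields \<open>V\<close>, \<open>W\<close>.
\<close>

definition ext_deriv :: "('a, 'v::euclidean_space) oneform \<Rightarrow> ('a, 'v) chart \<Rightarrow> 'v \<Rightarrow> 'v \<Rightarrow> 'v \<Rightarrow> real" where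
  "ext_deriv \<theta> c u v w = dderiv (\<lambda>u. \<theta> c u w) u v - dderiv (\<lambda>u. \<theta> c u v) u w"

definition closed_form :: "('a, 'v::euclidean_space) chart set \<Rightarrow> ('a, 'v) oneform \<Rightarrow> bool" where
  "closed_form A \<theta> \<longleftrightarrow> (\<forall>c\<in>A. \<forall>u\<in>chart_image c. \<forall>v w. ext_deriv \<theta> c u v w = 0)"

definition distribution ::
    "('a, 'v::euclidean_space) chart set \<Rightarrow> nat \<Rightarrow> ('a, 'v) dist \<Rightarrow> bool" where
  "distribution A r T \<longleftrightarrow>
     (\<forall>c\<in>A. \<forall>u\<in>chart_image c. subspace (T c u) \<and> dim (T c u) = r) \<and>
     (\<forall>c\<in>A. \<forall>u\<in>chart_image c. \<exists>N F. open N \<and> u \<in> N \<and> N \<subseteq> chart_image c \<and>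
        (\<forall>i<r. smooth_on N (F i)) \<and> (\<forall>x\<in>N. T c x = span ((\<lambda>i. F i x) ` {..<r}))) \<and>
     (\<forall>c\<in>A. \<forall>d\<in>A. \<forall>u\<in>overlap c d. let \<tau> = transition c d in
        T d (\<tau> u) = dderiv \<tau> u ` T c u)"

definition orthogonal_splitting ::
    "('a, 'v::euclidean_space) chart set \<Rightarrow> ('a, 'v) metric \<Rightarrow> ('a, 'v) dist \<Rightarrow> ('a, 'v) dist \<Rightarrow> bool" where
  "orthogonal_splitting A g T1 T2 \<longleftrightarrow> (\<forall>c\<in>A. \<forall>u\<in>chart_image c.
     T1 c u \<inter> T2 c u = {0} \<and> (\<forall>v. \<exists>v1\<in>T1 c u. \<exists>v2\<in>T2 c u. v = v1 + v2) \<and>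
     (\<forall>v1\<in>T1 c u. \<forall>v2\<in>T2 c u. g c u v1 v2 = 0))"

text \<open>The endomorphism that is the identity on \<open>T1\<close> and minus the identity on \<open>T2\<close>.\<close>

definition splitting_involution ::
    "('a, 'v::euclidean_space) dist \<Rightarrow> ('a, 'v) dist \<Rightarrow> ('a, 'v) endo" where
  "splitting_involution T1 T2 c u v =
     (THE w. \<exists>v1\<in>T1 c u. \<exists>v2\<in>T2 c u. v = v1 + v2 \<and> w = v1 - v2)"

definition sharp :: "('v::euclidean_space \<Rightarrow> 'v \<Rightarrow> real) \<Rightarrow> ('v \<Rightarrow> real) \<Rightarrow> 'v" where
  "sharp G \<alpha> = (THE v. \<forall>w. G v w = \<alpha> w)"

text \<open>A connection is represented in a chart by its Christoffel symbols.\<close>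

type_synonym ('a, 'v) conn = "('a, 'v) chart \<Rightarrow> 'v \<Rightarrow> 'v \<Rightarrow> 'v \<Rightarrow> 'v"

definition cov ::
    "('v::euclidean_space \<Rightarrow> 'v \<Rightarrow> 'v \<Rightarrow> 'v) \<Rightarrow> ('v \<Rightarrow> 'v) \<Rightarrow> ('v \<Rightarrow> 'v) \<Rightarrow> 'v \<Rightarrow> 'v" where
  "cov \<Gamma> X Y u = dderiv Y u (X u) + \<Gamma> u (X u) (Y u)"

text \<open>
  The transformation law says that \<open>\<tau>\<^sub>*(D\<^sub>X Y) = D\<^bsub>\<tau>\<^sub>*X\<^esub> (\<tau>\<^sub>*Y)\<close> for every transition map \<open>\<tau>\<close>.
\<close>

definition connection ::
    "('a, 'v::euclidean_space) chart set \<Rightarrow> ('a, 'v) conn \<Rightarrow> bool" where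
  "connection A D \<longleftrightarrow>
     (\<forall>c\<in>A. \<forall>u\<in>chart_image c. bilinear (D c u)) \<and>
     (\<forall>c\<in>A. \<forall>v w. smooth_on (chart_image c) (\<lambda>u. D c u v w)) \<and>
     (\<forall>c\<in>A. \<forall>d\<in>A. \<forall>u\<in>overlap c d. \<forall>v w. let \<tau> = transition c d in
        dderiv \<tau> u (D c u v w) =
          dderiv (\<lambda>x. dderiv \<tau> x w) u v + D d (\<tau> u) (dderiv \<tau> u v) (dderiv \<tau> u w))"

definition torsion_free ::
    "('a, 'v::euclidean_space) chart set \<Rightarrow> ('a, 'v) conn \<Rightarrow> bool" where
  "torsion_free A D \<longleftrightarrow> (\<forall>c\<in>A. \<forall>N X Y. open N \<and> N \<subseteq> chart_image c \<and> smooth_on N X \<and> smooth_on N Y \<longrightarrow>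
     (\<forall>u\<in>N. cov (D c) X Y u - cov (D c) Y X u = lie_bracket X Y u))"

definition metric_compatible ::
    "('a, 'v::euclidean_space) chart set \<Rightarrow> ('a, 'v) metric \<Rightarrow> ('a, 'v) conn \<Rightarrow> bool" where
  "metric_compatible A g D \<longleftrightarrow>
     (\<forall>c\<in>A. \<forall>N X Y Z. open N \<and> N \<subseteq> chart_image c \<and> smooth_on N X \<and> smooth_on N Y \<and> smooth_on N Z \<longrightarrow>
        (\<forall>u\<in>N. dderiv (\<lambda>x. g c x (Y x) (Z x)) u (X u) =
           g c u (cov (D c) X Y u) (Z u) + g c u (Y u) (cov (D c) X Z u)))"

definition levi_civita ::
    "('a, 'v::euclidean_space) chart set \<Rightarrow> ('a, 'v) metric \<Rightarrow> ('a, 'v) conn \<Rightarrow> bool" where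
  "levi_civita A g nabla \<longleftrightarrow>
     connection A nabla \<and> torsion_free A nabla \<and> metric_compatible A g nabla"

text \<open>In the next two definitions \<open>nabla\<close> stands for the Levi-Civita connection of \<open>g\<close>.\<close>

definition weyl_connection ::
    "('a, 'v::euclidean_space) chart set \<Rightarrow> ('a, 'v) metric \<Rightarrow> ('a, 'v) conn \<Rightarrow>
     ('a, 'v) conn \<Rightarrow> ('a, 'v) oneform \<Rightarrow> bool" where
  "weyl_connection A g nabla D \<theta> \<longleftrightarrow> connection A D \<and> one_form A \<theta> \<and>
     (\<forall>c\<in>A. \<forall>N X Y. open N \<and> N \<subseteq> chart_image c \<and> smooth_on N X \<and> smooth_on N Y \<longrightarrow>
        (\<forall>u\<in>N. cov (D c) X Y u =
           cov (nabla c) X Y u + \<theta> c u (Y u) *\<^sub>R X u + \<theta> c u (X u) *\<^sub>R Y u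
             - g c u (X u) (Y u) *\<^sub>R sharp (g c u) (\<theta> c u)))"

definition closed_weyl_connection ::
    "('a, 'v::euclidean_space) chart set \<Rightarrow> ('a, 'v) metric \<Rightarrow> ('a, 'v) conn \<Rightarrow>
     ('a, 'v) conn \<Rightarrow> bool" where
  "closed_weyl_connection A g nabla D \<longleftrightarrow>
     (\<exists>\<theta>. weyl_connection A g nabla D \<theta> \<and> closed_form A \<theta>)"

definition preserves_distribution ::
    "('a, 'v::euclidean_space) chart set \<Rightarrow> ('a, 'v) conn \<Rightarrow> ('a, 'v) dist \<Rightarrow> bool" where
  "preserves_distribution A D T \<longleftrightarrow>
     (\<forall>c\<in>A. \<forall>N X Y. open N \<and> N \<subseteq> chart_image c \<and> smooth_on N X \<and> smooth_on N Y \<and>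
        (\<forall>u\<in>N. Y u \<in> T c u) \<longrightarrow> (\<forall>u\<in>N. cov (D c) X Y u \<in> T c u))"

definition conformal_product ::
    "('a, 'v::euclidean_space) chart set \<Rightarrow> ('a, 'v) metric \<Rightarrow> ('a, 'v) conn \<Rightarrow> nat \<Rightarrow> nat \<Rightarrow>
     ('a, 'v) dist \<Rightarrow> ('a, 'v) dist \<Rightarrow> ('a, 'v) conn \<Rightarrow> ('a, 'v) oneform \<Rightarrow> bool" where
  "conformal_product A g nabla p q T1 T2 D \<theta> \<longleftrightarrow>
     distribution A p T1 \<and> distribution A q T2 \<and> orthogonal_splitting A g T1 T2 \<and>
     weyl_connection A g nabla D \<theta> \<and>
     preserves_distribution A D T1 \<and> preserves_distribution A D T2"

definition curvature ::
    "('v::euclidean_space \<Rightarrow> 'v \<Rightarrow> 'v \<Rightarrow> 'v) \<Rightarrow> ('v \<Rightarrow> 'v) \<Rightarrow> ('v \<Rightarrow> 'v) \<Rightarrow> ('v \<Rightarrow> 'v) \<Rightarrow> 'v \<Rightarrow> 'v" where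
  "curvature \<Gamma> X Y Z u =
     cov \<Gamma> X (cov \<Gamma> Y Z) u - cov \<Gamma> Y (cov \<Gamma> X Z) u - cov \<Gamma> (lie_bracket X Y) Z u"

text \<open>
  The curvature is tensorial, so its value on tangent vectors may be computed from their constant
  extensions in the chart.
\<close>

definition riem :: "('v::euclidean_space \<Rightarrow> 'v \<Rightarrow> 'v \<Rightarrow> 'v) \<Rightarrow> 'v \<Rightarrow> 'v \<Rightarrow> 'v \<Rightarrow> 'v \<Rightarrow> 'v" where
  "riem \<Gamma> u x y z = curvature \<Gamma> (\<lambda>_. x) (\<lambda>_. y) (\<lambda>_. z) u"

definition endo_trace :: "('v::euclidean_space \<Rightarrow> 'v) \<Rightarrow> real" where
  "endo_trace L = (\<Sum>b\<in>Basis. L b \<bullet> b)"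

definition ricci :: "('v::euclidean_space \<Rightarrow> 'v \<Rightarrow> 'v \<Rightarrow> 'v) \<Rightarrow> 'v \<Rightarrow> 'v \<Rightarrow> 'v \<Rightarrow> real" where
  "ricci \<Gamma> u y z = endo_trace (\<lambda>x. riem \<Gamma> u x y z)"

definition ricci_endo ::
    "('v::euclidean_space \<Rightarrow> 'v \<Rightarrow> real) \<Rightarrow> ('v \<Rightarrow> 'v \<Rightarrow> 'v \<Rightarrow> 'v) \<Rightarrow> 'v \<Rightarrow> 'v \<Rightarrow> 'v" where
  "ricci_endo G \<Gamma> u x = sharp G (ricci \<Gamma> u x)"

definition scalar_curvature ::
    "('v::euclidean_space \<Rightarrow> 'v \<Rightarrow> real) \<Rightarrow> ('v \<Rightarrow> 'v \<Rightarrow> 'v \<Rightarrow> 'v) \<Rightarrow> 'v \<Rightarrow> real" where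
  "scalar_curvature G \<Gamma> u = endo_trace (ricci_endo G \<Gamma> u)"

text \<open>
  The signs match the curvature convention above, for which the unit sphere has
  \<open>R\<^bsub>X,Y\<^esub> Z = g(Y,Z) X - g(X,Z) Y\<close>. The formula requires \<open>DIM('v) \<ge> 3\<close>.
\<close>

definition weyl_tensor ::
    "('a, 'v::euclidean_space) metric \<Rightarrow> ('a, 'v) conn \<Rightarrow> ('a, 'v) chart \<Rightarrow> 'v \<Rightarrow> 'v \<Rightarrow> 'v \<Rightarrow> 'v \<Rightarrow> 'v" where
  "weyl_tensor g nabla c u x y z =
     (let n = real DIM('v); G = g c u; R = riem (nabla c) u; Ric = ricci (nabla c) u;
          Q = ricci_endo G (nabla c) u; s = scalar_curvature G (nabla c) u
      in R x y z
         - (1 / (n - 2)) *\<^sub>R (Ric y z *\<^sub>R x - Ric x z *\<^sub>R y + G y z *\<^sub>R Q x - G x z *\<^sub>R Q y)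
         + (s / ((n - 1) * (n - 2))) *\<^sub>R (G y z *\<^sub>R x - G x z *\<^sub>R y))"

definition orthonormal_basis ::
    "('v::euclidean_space \<Rightarrow> 'v \<Rightarrow> real) \<Rightarrow> 'v set \<Rightarrow> bool" where
  "orthonormal_basis G E \<longleftrightarrow>
     span E = UNIV \<and> (\<forall>e\<in>E. \<forall>f\<in>E. G e f = (if e = f then 1 else 0))"

lemma orthonormal_basis_finite:
  assumes "bilinear G" "orthonormal_basis G E"
  shows "finite E"
proof -
  have "independent E"
    unfolding independent_explicit_module
  proof (intro allI impI)
    fix t a v
    assume t: "finite t" "t \<subseteq> E" "(\<Sum>v\<in>t. a v *\<^sub>R v) = 0" "v \<in> t"
    interpret l: linear "\<lambda>x. G x v" using assms(1) by (simp add: bilinear_def)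
    have "0 = G (\<Sum>x\<in>t. a x *\<^sub>R x) v" using t(3) l.zero by simp
    also have "\<dots> = (\<Sum>x\<in>t. a x * G x v)" by (simp add: l.sum l.scale)
    also have "\<dots> = (\<Sum>x\<in>t. if x = v then a x else 0)"
      using assms(2) subsetD[OF t(2)] t(4) by (intro sum.cong) (auto simp: orthonormal_basis_def)
    also have "\<dots> = a v" using t by simp
    finally show "a v = 0" by simp
  qed
  then show ?thesis using independent_bound by blast
qed

lemma orthonormal_basis_expand:
  assumes "bilinear G" "orthonormal_basis G E"
  shows "v = (\<Sum>e\<in>E. G v e *\<^sub>R e)"
proof -
  note fin = orthonormal_basis_finite[OF assms]
  have "v \<in> span E" using assms(2) by (simp add: orthonormal_basis_def)
  then obtain a where a: "v = (\<Sum>e\<in>E. a e *\<^sub>R e)"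
    using span_finite[OF fin] by auto
  have "G v f = a f" if "f \<in> E" for f
  proof -
    interpret l: linear "\<lambda>x. G x f" using assms(1) by (simp add: bilinear_def)
    have "G v f = (\<Sum>x\<in>E. a x * G x f)" unfolding a by (simp add: l.sum l.scale)
    also have "\<dots> = (\<Sum>x\<in>E. if x = f then a x else 0)"
      using assms(2) that by (intro sum.cong) (auto simp: orthonormal_basis_def)
    finally show ?thesis using fin that by simp
  qed
  then show ?thesis using a by simp
qed

text \<open>Contractions with the metric do not depend on the chosen orthonormal basis.\<close>

lemma orthonormal_basis_sum_unique:
  fixes B :: "'v::euclidean_space \<Rightarrow> 'v \<Rightarrow> 'w::real_vector"
  assumes G: "bilinear G" "\<And>v w. G v w = G w v" and B: "bilinear B"
    and E: "orthonormal_basis G E" and F: "orthonormal_basis G F"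
  shows "(\<Sum>e\<in>E. B e e) = (\<Sum>f\<in>F. B f f)"
proof -
  note finE = orthonormal_basis_finite[OF G(1) E] and finF = orthonormal_basis_finite[OF G(1) F]
  have B1: "B (\<Sum>x\<in>S. a x *\<^sub>R h x) y = (\<Sum>x\<in>S. a x *\<^sub>R B (h x) y)"
    for S :: "'v set" and a h y
  proof -
    interpret l: linear "\<lambda>x. B x y" using B by (simp add: bilinear_def)
    show ?thesis by (simp add: l.sum l.scale)
  qed
  have B2: "B y (\<Sum>x\<in>S. a x *\<^sub>R h x) = (\<Sum>x\<in>S. a x *\<^sub>R B y (h x))"
    for S :: "'v set" and a h y
  proof -
    interpret l: linear "B y" using B by (simp add: bilinear_def)
    show ?thesis by (simp add: l.sum l.scale)
  qed
  have "(\<Sum>e\<in>E. B e e) = (\<Sum>e\<in>E. B (\<Sum>f\<in>F. G e f *\<^sub>R f) e)"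
    using orthonormal_basis_expand[OF G(1) F] by simp
  also have "\<dots> = (\<Sum>e\<in>E. \<Sum>f\<in>F. G e f *\<^sub>R B f e)" by (simp only: B1)
  also have "\<dots> = (\<Sum>f\<in>F. \<Sum>e\<in>E. G f e *\<^sub>R B f e)"
    by (subst sum.swap) (simp add: G(2))
  also have "\<dots> = (\<Sum>f\<in>F. B f (\<Sum>e\<in>E. G f e *\<^sub>R e))" by (simp only: B2)
  also have "\<dots> = (\<Sum>f\<in>F. B f f)"
    using orthonormal_basis_expand[OF G(1) E] by simp
  finally show ?thesis .
qed

definition weyl_contraction ::
    "('a, 'v::euclidean_space) metric \<Rightarrow> ('a, 'v) conn \<Rightarrow> ('a, 'v) endo \<Rightarrow> ('a, 'v) endo" where
  "weyl_contraction g nabla S c u x =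
     (\<Sum>e\<in>(SOME E. orthonormal_basis (g c u) E). weyl_tensor g nabla c u x e (S c u e))"

definition commutator :: "('a, 'v::euclidean_space) endo \<Rightarrow> ('a, 'v) endo \<Rightarrow> ('a, 'v) endo" where
  "commutator K L c u v = K c u (L c u v) - L c u (K c u v)"

definition vanishing_endo :: "('a, 'v::euclidean_space) chart set \<Rightarrow> ('a, 'v) endo \<Rightarrow> bool" where
  "vanishing_endo A K \<longleftrightarrow> (\<forall>c\<in>A. \<forall>u\<in>chart_image c. \<forall>v. K c u v = 0)"

definition endo_preserves ::
    "('a, 'v::euclidean_space) chart set \<Rightarrow> ('a, 'v) endo \<Rightarrow> ('a, 'v) dist \<Rightarrow> bool" where
  "endo_preserves A K T \<longleftrightarrow> (\<forall>c\<in>A. \<forall>u\<in>chart_image c. \<forall>v\<in>T c u. K c u v \<in> T c u)"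

end

theory Submission
  imports Defs
begin

text \<open>
  Write \<open>F = d\<theta>\<close>, \<open>n = p + q\<close>, and let \<open>R\<^sup>D\<close> be the curvature of \<open>D\<close>. The idea is to compute the
  off-diagonal blocks of the contracted Weyl tensor \<open>K\<close> explicitly:
  \<open>g(K x, v) = - c F(x,v)\<close> for \<open>x \<in> T\<^sub>2\<close>, \<open>v \<in> T\<^sub>1\<close>, and \<open>g(K x, v) = c F(x,v)\<close> for \<open>x \<in> T\<^sub>1\<close>,
  \<open>v \<in> T\<^sub>2\<close>, with \<open>c = 2 (p - 1) (q - 1) / (n - 2)\<close>. This is \<open>weyl_mixed_contraction\<close>. The
  constant is nonzero exactly because both ranks are at least 2. Since \<open>F\<close> vanishes on
  \<open>T\<^sub>1 \<times> T\<^sub>1\<close> and on \<open>T\<^sub>2 \<times> T\<^sub>2\<close> for every conformal product (\<open>F_same_factor\<close>), it follows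
  that \<open>F = 0\<close> if and only if \<open>K\<close> preserves both factors, or equivalently commutes with \<open>S\<close>.

  Three properties of \<open>R\<^sup>D\<close> carry the computation: it preserves \<open>T\<^sub>1\<close> and \<open>T\<^sub>2\<close>, because \<open>D\<close> does
  (\<open>riem_preserves\<close>); it satisfies the first Bianchi identity, because \<open>D\<close> is torsion-free; and its
  symmetric part with respect to \<open>g\<close> is \<open>F \<otimes> g\<close>. For \<open>x, y \<in> T\<^sub>1\<close> and \<open>z \<in> T\<^sub>2\<close> the
  first two force \<open>R\<^sup>D\<^sub>x\<^sub>,\<^sub>y z = 0\<close>, and the third then gives \<open>F(x,y) = 0\<close>. For \<open>x \<in> T\<^sub>2\<close>
  they determine the \<open>T\<^sub>1\<close>-part of \<open>R\<^sup>D\<^sub>x\<^sub>,\<^sub>e e\<close> with \<open>e \<in> T\<^sub>1\<close> in terms of \<open>F\<close> alone. The formula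
  relating \<open>R\<^sup>D\<close> to the Riemannian curvature (\<open>riem_weyl\<close>) turns this into the two partial sums of
  the mixed Ricci curvature over the two factors, and \<open>K\<close> is a linear combination of these sums in
  which the contribution of \<open>\<nabla>\<theta>\<close> cancels.

  Finally, \<open>D\<close> determines its Lee form (\<open>lee_form_unique\<close>), so closedness of \<open>D\<close> means \<open>d\<theta> = 0\<close>.
\<close>

section \<open>Calculus of smooth maps\<close>

lemma differentiable_on_open_at:
  "f differentiable_on N \<Longrightarrow> open N \<Longrightarrow> u \<in> N \<Longrightarrow> f differentiable at u"
  by (metis differentiable_on_def at_within_open)

lemma dderiv_unique: "(f has_derivative f') (at u) \<Longrightarrow> dderiv f u v = f' v"
  by (simp add: frechet_derivative_at [symmetric])

lemma has_derivative_dderiv: "f differentiable at u \<Longrightarrow> (f has_derivative dderiv f u) (at u)"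
  by (simp add: frechet_derivative_works [symmetric])

lemma dderiv_cong:
  assumes "f differentiable at u" "open N" "u \<in> N" "\<And>x. x \<in> N \<Longrightarrow> f x = g x"
  shows "dderiv f u v = dderiv g u v"
  using frechet_derivative_transform_within_open [OF assms] by simp

lemma dderiv_linear: "f differentiable at u \<Longrightarrow> linear (dderiv f u)"
  by (rule linear_frechet_derivative)

lemma Ck_on_cong:
  assumes "open N" "\<And>x. x \<in> N \<Longrightarrow> f x = g x" "Ck_on k N f"
  shows "Ck_on k N g"
  using assms(2,3)
proof (induction k arbitrary: f g)
  case 0
  then show ?case using continuous_on_cong by (metis Ck_on.simps(1))
next
  case (Suc k)
  have "g differentiable_on N"
    using Suc.prems by (metis Ck_on.simps(2) differentiable_on_def differentiable_transform_within
        zero_less_one)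
  moreover have "Ck_on k N (\<lambda>u. dderiv g u v)" for v
  proof (rule Suc.IH)
    show "Ck_on k N (\<lambda>u. dderiv f u v)" using Suc.prems by simp
    show "dderiv f x v = dderiv g x v" if "x \<in> N" for x
      using that Suc.prems assms(1) by (intro dderiv_cong differentiable_on_open_at) auto
  qed
  ultimately show ?case by simp
qed

lemma Ck_on_subset: "Ck_on k N f \<Longrightarrow> N' \<subseteq> N \<Longrightarrow> Ck_on k N' f"
  by (induction k arbitrary: f) (auto intro: continuous_on_subset differentiable_on_subset)

lemma Ck_on_Suc: "Ck_on (Suc k) N f \<Longrightarrow> Ck_on k N f"
  by (induction k arbitrary: f) (auto intro: differentiable_imp_continuous_on)

lemma Ck_on_const: "Ck_on k N (\<lambda>_. c)"
  by (induction k arbitrary: c) auto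

lemma Ck_on_add:
  assumes "open N"
  shows "Ck_on k N f \<Longrightarrow> Ck_on k N g \<Longrightarrow> Ck_on k N (\<lambda>x. f x + g x)"
proof (induction k arbitrary: f g)
  case 0
  then show ?case by (simp add: continuous_on_add)
next
  case (Suc k)
  have "Ck_on k N (\<lambda>u. dderiv (\<lambda>x. f x + g x) u v)" for v
  proof (rule Ck_on_cong [OF assms])
    show "Ck_on k N (\<lambda>u. dderiv f u v + dderiv g u v)" using Suc by simp
    show "dderiv f u v + dderiv g u v = dderiv (\<lambda>x. f x + g x) u v" if "u \<in> N" for u
      using that Suc.prems assms
      by (intro dderiv_unique [symmetric] has_derivative_add has_derivative_dderiv
          differentiable_on_open_at) auto
  qed
  then show ?case using Suc.prems by simp
qed

lemma Ck_on_bilinear: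
  fixes f :: "'v::real_normed_vector \<Rightarrow> 'a::real_normed_vector"
    and g :: "'v \<Rightarrow> 'b::real_normed_vector"
  assumes "open N" and bb: "bounded_bilinear h"
  shows "Ck_on k N f \<Longrightarrow> Ck_on k N g \<Longrightarrow> Ck_on k N (\<lambda>x. h (f x) (g x))"
proof (induction k arbitrary: f g)
  case 0
  then show ?case by (simp add: bounded_bilinear.continuous_on [OF bb])
next
  case (Suc k)
  have D: "((\<lambda>x. h (f x) (g x)) has_derivative (\<lambda>v. h (f u) (dderiv g u v) + h (dderiv f u v) (g u)))
      (at u)" if "u \<in> N" for u
    using that Suc.prems assms
    by (intro bounded_bilinear.FDERIV [OF bb] has_derivative_dderiv differentiable_on_open_at) auto
  have "Ck_on k N (\<lambda>u. dderiv (\<lambda>x. h (f x) (g x)) u v)" for v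
  proof (rule Ck_on_cong [OF assms(1)])
    show "Ck_on k N (\<lambda>u. h (f u) (dderiv g u v) + h (dderiv f u v) (g u))"
      using Suc.prems by (intro Ck_on_add assms Suc.IH) (auto intro: Ck_on_Suc)
    show "h (f u) (dderiv g u v) + h (dderiv f u v) (g u) = dderiv (\<lambda>x. h (f x) (g x)) u v"
      if "u \<in> N" for u
      using dderiv_unique [OF D [OF that]] by simp
  qed
  moreover have "(\<lambda>x. h (f x) (g x)) differentiable_on N"
    using D by (auto simp: differentiable_on_def differentiable_def intro: has_derivative_at_withinI)
  ultimately show ?case by simp
qed

lemma smooth_on_const: "smooth_on N (\<lambda>_. c)"
  by (simp add: smooth_on_def Ck_on_const)

lemma smooth_on_subset: "smooth_on N f \<Longrightarrow> N' \<subseteq> N \<Longrightarrow> smooth_on N' f"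
  by (auto simp: smooth_on_def intro: Ck_on_subset)

lemma smooth_on_cong: "open N \<Longrightarrow> (\<And>x. x \<in> N \<Longrightarrow> f x = g x) \<Longrightarrow> smooth_on N f \<Longrightarrow> smooth_on N g"
  unfolding smooth_on_def using Ck_on_cong [of N f g] by blast

lemma smooth_on_add:
  "open N \<Longrightarrow> smooth_on N f \<Longrightarrow> smooth_on N g \<Longrightarrow> smooth_on N (\<lambda>x. f x + g x)"
  unfolding smooth_on_def by (blast intro: Ck_on_add)

lemma smooth_on_sum:
  assumes "open N" "finite I" "\<And>i. i \<in> I \<Longrightarrow> smooth_on N (f i)"
  shows "smooth_on N (\<lambda>x. \<Sum>i\<in>I. f i x)"
  using assms(2,3) by (induction I rule: finite_induct) (auto intro: smooth_on_const smooth_on_add assms(1))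

lemma smooth_on_bilinear:
  "open N \<Longrightarrow> bounded_bilinear h \<Longrightarrow> smooth_on N f \<Longrightarrow> smooth_on N g \<Longrightarrow> smooth_on N (\<lambda>x. h (f x) (g x))"
  unfolding smooth_on_def by (simp add: Ck_on_bilinear)

lemma smooth_on_scaleR:
  "open N \<Longrightarrow> smooth_on N f \<Longrightarrow> smooth_on N g \<Longrightarrow> smooth_on N (\<lambda>x. f x *\<^sub>R g x)"
  by (rule smooth_on_bilinear [OF _ bounded_bilinear_scaleR])

lemma smooth_on_inner: "open N \<Longrightarrow> smooth_on N f \<Longrightarrow> smooth_on N (\<lambda>x. f x \<bullet> k)"
  using smooth_on_bilinear [OF _ bounded_bilinear_inner _ smooth_on_const] .

lemma smooth_on_dderiv: "smooth_on N f \<Longrightarrow> smooth_on N (\<lambda>u. dderiv f u v)"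
  by (metis smooth_on_def Ck_on.simps(2))

lemma smooth_on_differentiable_at: "smooth_on N f \<Longrightarrow> open N \<Longrightarrow> u \<in> N \<Longrightarrow> f differentiable at u"
  by (metis smooth_on_def Ck_on.simps(2) differentiable_on_open_at)

lemma smooth_on_continuous_on: "smooth_on N f \<Longrightarrow> continuous_on N f"
  by (metis smooth_on_def Ck_on.simps(1))

lemma linear_basis_expansion: "linear (T :: 'v::euclidean_space \<Rightarrow> 'w::real_vector) \<Longrightarrow> T w = (\<Sum>b\<in>Basis. (w \<bullet> b) *\<^sub>R T b)"
  by (metis (no_types, lifting) euclidean_representation linear_scale linear_sum sum.cong)

lemma smooth_on_apply_linear:
  fixes T :: "'v::euclidean_space \<Rightarrow> 'w::euclidean_space \<Rightarrow> 'x::real_normed_vector"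
  assumes "open N" "\<And>u. u \<in> N \<Longrightarrow> linear (T u)" "\<And>w. smooth_on N (\<lambda>u. T u w)" "smooth_on N Z"
  shows "smooth_on N (\<lambda>u. T u (Z u))"
proof (rule smooth_on_cong [OF assms(1)])
  show "smooth_on N (\<lambda>u. \<Sum>b\<in>Basis. (Z u \<bullet> b) *\<^sub>R T u b)"
    by (intro smooth_on_sum smooth_on_scaleR smooth_on_inner assms) auto
  show "(\<Sum>b\<in>Basis. (Z u \<bullet> b) *\<^sub>R T u b) = T u (Z u)" if "u \<in> N" for u
    using linear_basis_expansion [OF assms(2) [OF that]] by metis
qed

text \<open>
  The product rule for a field \<open>T\<close> of linear maps applied to a vector field \<open>Z\<close>: the first term
  freezes the argument of \<open>T\<close> at \<open>Z u\<close>. Below, \<open>T\<close> comes from Christoffel symbols or from the metric.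
  Expanding in \<open>Basis\<close> reduces the rule to products of a scalar and a vector function.
\<close>

lemma dderiv_apply_linear:
  fixes T :: "'v::euclidean_space \<Rightarrow> 'w::euclidean_space \<Rightarrow> 'x::real_normed_vector"
  assumes N: "open N" "u \<in> N" "\<And>x. x \<in> N \<Longrightarrow> linear (T x)"
    and T: "\<And>w. (\<lambda>x. T x w) differentiable at u" and Z: "Z differentiable at u"
  shows "dderiv (\<lambda>x. T x (Z x)) u v = dderiv (\<lambda>x. T x (Z u)) u v + T u (dderiv Z u v)"
proof -
  let ?S = "\<lambda>Z x. \<Sum>b\<in>Basis. (Z x \<bullet> b) *\<^sub>R T x b"
  have D: "(?S Z has_derivative (\<lambda>v. \<Sum>b\<in>Basis. (Z u \<bullet> b) *\<^sub>R dderiv (\<lambda>x. T x b) u v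
      + (dderiv Z u v \<bullet> b) *\<^sub>R T u b)) (at u)" if "Z differentiable at u" for Z
    using that T by (auto intro!: derivative_eq_intros has_derivative_dderiv)
  have E: "dderiv (\<lambda>x. T x (Z x)) u v = (\<Sum>b\<in>Basis. (Z u \<bullet> b) *\<^sub>R dderiv (\<lambda>x. T x b) u v
      + (dderiv Z u v \<bullet> b) *\<^sub>R T u b)" if "Z differentiable at u" for Z
  proof (rule dderiv_unique, rule has_derivative_transform_within_open [OF D [OF that] N(1,2)])
    show "?S Z x = T x (Z x)" if "x \<in> N" for x
      using linear_basis_expansion [OF N(3) [OF that]] by metis
  qed
  have "T u (dderiv Z u v) = (\<Sum>b\<in>Basis. (dderiv Z u v \<bullet> b) *\<^sub>R T u b)"
    by (rule linear_basis_expansion [OF N(3) [OF N(2)]])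
  moreover have "dderiv (\<lambda>x. T x (Z u)) u v = (\<Sum>b\<in>Basis. (Z u \<bullet> b) *\<^sub>R dderiv (\<lambda>x. T x b) u v)"
    using E [of "\<lambda>_. Z u"] by simp
  ultimately show ?thesis using E [OF Z] by (simp add: sum.distrib)
qed

lemma DERIV_along_line:
  fixes f :: "'v::real_normed_vector \<Rightarrow> real"
  assumes "f differentiable at (c + s *\<^sub>R a)"
  shows "((\<lambda>s. f (c + s *\<^sub>R a)) has_real_derivative dderiv f (c + s *\<^sub>R a) a) (at s)"
proof -
  have "(f has_derivative dderiv f (c + s *\<^sub>R a)) (at (c + s *\<^sub>R a))"
    using assms by (rule has_derivative_dderiv)
  then have "((\<lambda>s. f (c + s *\<^sub>R a)) has_derivative (\<lambda>h. dderiv f (c + s *\<^sub>R a) (h *\<^sub>R a))) (at s)"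
    by (rule has_derivative_compose [rotated]) (auto intro!: derivative_eq_intros)
  moreover have "dderiv f (c + s *\<^sub>R a) (h *\<^sub>R a) = dderiv f (c + s *\<^sub>R a) a * h" for h
    using linear_scale [OF dderiv_linear [OF assms]] by simp
  ultimately show ?thesis by (simp add: has_field_derivative_def)
qed

text \<open>
  The mean value theorem is applied first in direction \<open>a\<close> to the increment of \<open>f\<close> along \<open>h b\<close>,
  and then in direction \<open>b\<close>. The second difference on the left is symmetric in \<open>a\<close> and \<open>b\<close>; this
  is what makes mixed partial derivatives commute.
\<close>

lemma second_difference_mean_value:
  fixes f :: "'v::real_normed_vector \<Rightarrow> real"
  assumes f: "\<And>x. x \<in> ball u r \<Longrightarrow> f differentiable at x"
    and df: "\<And>x. x \<in> ball u r \<Longrightarrow> (\<lambda>x. dderiv f x a) differentiable at x"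
    and h: "0 < h" "h * (norm a + norm b) < r"
  shows "\<exists>s t. 0 < s \<and> s < h \<and> 0 < t \<and> t < h \<and>
     f (u + h *\<^sub>R a + h *\<^sub>R b) - f (u + h *\<^sub>R a) - f (u + h *\<^sub>R b) + f u =
     h * h * dderiv (\<lambda>x. dderiv f x a) (u + s *\<^sub>R a + t *\<^sub>R b) b"
proof -
  have inb: "u + s *\<^sub>R a + t *\<^sub>R b \<in> ball u r" if "0 \<le> s" "s \<le> h" "0 \<le> t" "t \<le> h" for s t
  proof -
    have "norm (s *\<^sub>R a + t *\<^sub>R b) \<le> h * norm a + h * norm b"
      using that by (intro order.trans [OF norm_triangle_ineq] add_mono) (auto intro: mult_right_mono)
    then show ?thesis using h by (simp add: dist_norm norm_minus_commute algebra_simps)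
  qed
  have inb': "u + s *\<^sub>R a \<in> ball u r" if "0 \<le> s" "s \<le> h" for s
    using inb [OF that, of 0] h by simp
  let ?G = "\<lambda>s. f ((u + h *\<^sub>R b) + s *\<^sub>R a) - f (u + s *\<^sub>R a)"
  have "\<exists>s>0. s < h \<and> ?G h - ?G 0 =
      (h - 0) * (dderiv f ((u + h *\<^sub>R b) + s *\<^sub>R a) a - dderiv f (u + s *\<^sub>R a) a)"
  proof (rule MVT2 [OF h(1)])
    fix s :: real assume "0 \<le> s" "s \<le> h"
    then have "f differentiable at ((u + h *\<^sub>R b) + s *\<^sub>R a)" "f differentiable at (u + s *\<^sub>R a)"
      using f [OF inb [of s h]] f [OF inb' [of s]] h by (simp_all add: algebra_simps)
    then show "(?G has_real_derivative
        dderiv f ((u + h *\<^sub>R b) + s *\<^sub>R a) a - dderiv f (u + s *\<^sub>R a) a) (at s)"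
      by (intro DERIV_diff DERIV_along_line)
  qed
  then obtain s where s: "0 < s" "s < h" "?G h - ?G 0 =
      h * (dderiv f ((u + h *\<^sub>R b) + s *\<^sub>R a) a - dderiv f (u + s *\<^sub>R a) a)" by auto
  let ?H = "\<lambda>t. dderiv f ((u + s *\<^sub>R a) + t *\<^sub>R b) a"
  have "\<exists>t>0. t < h \<and> ?H h - ?H 0 =
      (h - 0) * dderiv (\<lambda>x. dderiv f x a) ((u + s *\<^sub>R a) + t *\<^sub>R b) b"
    by (rule MVT2 [OF h(1)], rule DERIV_along_line, rule df, rule inb) (use s in auto)
  then obtain t where t: "0 < t" "t < h" "?H h - ?H 0 =
      h * dderiv (\<lambda>x. dderiv f x a) ((u + s *\<^sub>R a) + t *\<^sub>R b) b" by auto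
  have "?G h - ?G 0 = h * (?H h - ?H 0)"
    unfolding s(3) by (simp add: add.commute add.left_commute)
  then show ?thesis
    using s(1,2) t by (intro exI [of _ s] exI [of _ t]) (simp add: algebra_simps)
qed

text \<open>
  Both orders of differentiation represent the same second difference, at two points that converge
  to \<open>u\<close> as the step \<open>h\<close> shrinks; continuity of the second derivatives then gives equality.
\<close>

lemma mixed_partials_commute_real:
  fixes f :: "'v::real_normed_vector \<Rightarrow> real"
  assumes f: "smooth_on N f" and N: "open N" "u \<in> N"
  shows "dderiv (\<lambda>x. dderiv f x b) u a = dderiv (\<lambda>x. dderiv f x a) u b"
proof -
  let ?P = "\<lambda>x. dderiv (\<lambda>x. dderiv f x a) x b" and ?Q = "\<lambda>x. dderiv (\<lambda>x. dderiv f x b) x a"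
  have cont: "continuous (at u) (\<lambda>x. dderiv (\<lambda>x. dderiv f x v) x w)" for v w
    using smooth_on_continuous_on [OF smooth_on_dderiv [OF smooth_on_dderiv [OF f]]] N
    by (simp add: continuous_on_eq_continuous_at)
  have "\<bar>?P u - ?Q u\<bar> \<le> 0 + e" if e: "e > 0" for e
  proof -
    obtain r0 where r0: "r0 > 0" "ball u r0 \<subseteq> N" using N openE by blast
    obtain r1 where r1: "r1 > 0" "\<And>x. dist x u < r1 \<Longrightarrow> dist (?P x) (?P u) < e / 2"
      using cont e unfolding continuous_at_eps_delta by (meson half_gt_zero)
    obtain r2 where r2: "r2 > 0" "\<And>x. dist x u < r2 \<Longrightarrow> dist (?Q x) (?Q u) < e / 2"
      using cont e unfolding continuous_at_eps_delta by (meson half_gt_zero)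
    define r where "r = min r0 (min r1 r2)"
    define h where "h = r / (2 * (norm a + norm b + 1))"
    have r: "r > 0" using r0 r1 r2 by (simp add: r_def)
    have k: "norm a + norm b + 1 > 0" using norm_ge_zero [of a] norm_ge_zero [of b] by linarith
    have h: "h > 0" using r k by (simp add: h_def)
    have "2 * (h * (norm a + norm b + 1)) = r"
      using k by (simp add: h_def field_simps)
    then have hr: "h * (norm a + norm b) < r" using h r by (simp add: algebra_simps)
    then have hr': "h * (norm b + norm a) < r" by (simp add: add.commute)
    have sm: "f differentiable at x" "(\<lambda>x. dderiv f x v) differentiable at x" if "x \<in> ball u r" for x v
      using that r0 N f by (auto intro!: smooth_on_differentiable_at [where N = N] smooth_on_dderiv simp: r_def)
    obtain s t where st: "0 < s" "s < h" "0 < t" "t < h"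
      "f (u + h *\<^sub>R a + h *\<^sub>R b) - f (u + h *\<^sub>R a) - f (u + h *\<^sub>R b) + f u = h * h * ?P (u + s *\<^sub>R a + t *\<^sub>R b)"
      using second_difference_mean_value [OF sm(1) sm(2) h hr] by blast
    obtain s' t' where st': "0 < s'" "s' < h" "0 < t'" "t' < h"
      "f (u + h *\<^sub>R b + h *\<^sub>R a) - f (u + h *\<^sub>R b) - f (u + h *\<^sub>R a) + f u = h * h * ?Q (u + s' *\<^sub>R b + t' *\<^sub>R a)"
      using second_difference_mean_value [OF sm(1) sm(2) h hr'] by blast
    have close: "dist (u + s *\<^sub>R v + t *\<^sub>R w) u < r"
      if "0 < s" "s < h" "0 < t" "t < h" "h * (norm v + norm w) < r" for s t v w
    proof -
      have "norm (s *\<^sub>R v + t *\<^sub>R w) \<le> h * norm v + h * norm w"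
        using that by (intro order.trans [OF norm_triangle_ineq] add_mono) (auto intro: mult_right_mono)
      then show ?thesis using that by (simp add: dist_norm algebra_simps)
    qed
    have "h * h * ?P (u + s *\<^sub>R a + t *\<^sub>R b) = h * h * ?Q (u + s' *\<^sub>R b + t' *\<^sub>R a)"
      using st(5) st'(5) by (simp add: algebra_simps)
    then have eq: "?P (u + s *\<^sub>R a + t *\<^sub>R b) = ?Q (u + s' *\<^sub>R b + t' *\<^sub>R a)" using h by simp
    have "dist (?P (u + s *\<^sub>R a + t *\<^sub>R b)) (?P u) < e / 2"
      using close [OF st(1-4) hr] by (intro r1(2)) (simp add: r_def)
    moreover have "dist (?Q (u + s' *\<^sub>R b + t' *\<^sub>R a)) (?Q u) < e / 2"
      using close [OF st'(1-4)] hr by (intro r2(2)) (simp add: r_def add.commute)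
    ultimately show ?thesis using eq unfolding dist_real_def by linarith
  qed
  then have "\<bar>?P u - ?Q u\<bar> \<le> 0" by (rule field_le_epsilon)
  then show ?thesis by simp
qed

lemma dderiv_inner:
  fixes f :: "'v::real_normed_vector \<Rightarrow> 'w::real_inner"
  shows "f differentiable at u \<Longrightarrow> dderiv (\<lambda>x. f x \<bullet> k) u v = dderiv f u v \<bullet> k"
  by (rule dderiv_unique) (auto intro!: derivative_eq_intros has_derivative_dderiv)

lemma mixed_partials_commute:
  fixes f :: "'v::real_normed_vector \<Rightarrow> 'w::euclidean_space"
  assumes f: "smooth_on N f" and N: "open N" "u \<in> N"
  shows "dderiv (\<lambda>x. dderiv f x b) u a = dderiv (\<lambda>x. dderiv f x a) u b"
proof (rule euclidean_eqI)
  fix k :: 'w assume "k \<in> Basis"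
  have sw: "dderiv (\<lambda>x. dderiv (\<lambda>x. f x \<bullet> k) x v) u w = dderiv (\<lambda>x. dderiv f x v) u w \<bullet> k" for v w
  proof -
    have d: "(\<lambda>x. dderiv f x v \<bullet> k) differentiable at u"
      using smooth_on_inner [OF N(1) smooth_on_dderiv [OF f]] N by (rule smooth_on_differentiable_at)
    have "dderiv (\<lambda>x. dderiv f x v \<bullet> k) u w = dderiv (\<lambda>x. dderiv (\<lambda>x. f x \<bullet> k) x v) u w"
      using f N by (intro dderiv_cong [OF d N] dderiv_inner [symmetric] smooth_on_differentiable_at)
    moreover have "dderiv (\<lambda>x. dderiv f x v \<bullet> k) u w = dderiv (\<lambda>x. dderiv f x v) u w \<bullet> k"
      using f N by (intro dderiv_inner smooth_on_differentiable_at [OF smooth_on_dderiv])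
    ultimately show ?thesis by simp
  qed
  show "dderiv (\<lambda>x. dderiv f x b) u a \<bullet> k = dderiv (\<lambda>x. dderiv f x a) u b \<bullet> k"
    using mixed_partials_commute_real [OF smooth_on_inner [OF N(1) f] N, of k b a] by (simp add: sw)
qed

section \<open>Orthonormal bases of an inner product\<close>

locale inner_form =
  fixes G :: "'v::euclidean_space \<Rightarrow> 'v \<Rightarrow> real"
  assumes bil: "bilinear G" and sym: "G v w = G w v" and pos: "v \<noteq> 0 \<Longrightarrow> 0 < G v v"
begin

lemmas G_simps = bilinear_ladd [OF bil] bilinear_radd [OF bil] bilinear_lmul [OF bil]
  bilinear_rmul [OF bil] bilinear_lneg [OF bil] bilinear_rneg [OF bil] bilinear_lzero [OF bil]
  bilinear_rzero [OF bil] bilinear_lsub [OF bil] bilinear_rsub [OF bil]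

lemma linear_left: "linear (\<lambda>v. G v w)" and linear_right: "linear (G v)"
  using bil by (simp_all add: bilinear_def)

lemma G_sum_left: "G (sum f I) w = (\<Sum>i\<in>I. G (f i) w)"
  using linear_sum [OF linear_left] by blast

lemma eqI: "(\<And>w. G v w = G v' w) \<Longrightarrow> v = v'"
  using pos [of "v - v'"] by (force simp: G_simps)

text \<open>
  Unlike \<open>orthonormal_basis\<close>, this does not ask for a spanning set, so that it also applies to bases
  of the two factors of the splitting.
\<close>

definition orthonormal :: "'v set \<Rightarrow> bool" where
  "orthonormal E \<longleftrightarrow> finite E \<and> (\<forall>e\<in>E. \<forall>f\<in>E. G e f = (if e = f then 1 else 0))"

lemma orthonormal_coeff:
  assumes "orthonormal E" "f \<in> E"
  shows "G (\<Sum>e\<in>E. a e *\<^sub>R e) f = a f"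
proof -
  have "G (\<Sum>e\<in>E. a e *\<^sub>R e) f = (\<Sum>e\<in>E. a e * G e f)"
    by (simp add: G_sum_left G_simps)
  also have "\<dots> = (\<Sum>e\<in>E. if e = f then a e else 0)"
    using assms by (intro sum.cong) (auto simp: orthonormal_def)
  finally show ?thesis using assms by (simp add: orthonormal_def)
qed

lemma orthonormal_expand:
  assumes "orthonormal E" "v \<in> span E"
  shows "v = (\<Sum>e\<in>E. G v e *\<^sub>R e)"
proof -
  have "finite E" using assms by (simp add: orthonormal_def)
  then obtain a where a: "v = (\<Sum>e\<in>E. a e *\<^sub>R e)"
    using assms(2) span_finite by auto
  then show ?thesis using orthonormal_coeff [OF assms(1), of _ a] by simp
qed

lemma linear_expand:
  assumes "orthonormal E" "v \<in> span E" "linear f"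
  shows "f v = (\<Sum>e\<in>E. G v e *\<^sub>R f e)"
proof -
  have "f v = f (\<Sum>e\<in>E. G v e *\<^sub>R e)" using orthonormal_expand [OF assms(1,2)] by simp
  then show ?thesis by (simp add: linear_sum [OF assms(3)] linear_scale [OF assms(3)])
qed

lemma orthonormal_card:
  assumes "orthonormal E"
  shows "card E = dim (span E)"
proof -
  have "independent E"
    unfolding independent_explicit_module
  proof (intro allI impI)
    fix t a v
    assume t: "finite t" "t \<subseteq> E" "(\<Sum>v\<in>t. a v *\<^sub>R v) = 0" "v \<in> t"
    have "orthonormal t" using assms t(1,2) unfolding orthonormal_def by blast
    from orthonormal_coeff [OF this t(4), of a] t(3) show "a v = 0" by (simp add: G_simps)
  qed
  then show ?thesis by (simp add: dim_span dim_eq_card_independent)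
qed

text \<open>
  One Gram-Schmidt step: the new vector is replaced by its component \<open>d\<close> orthogonal to the earlier
  ones, which is then dropped if it is zero and normalised otherwise.
\<close>

lemma gram_schmidt:
  assumes "finite B"
  shows "\<exists>E. orthonormal E \<and> span E = span B"
  using assms
proof (induction B)
  case empty
  have "orthonormal {}" by (simp add: orthonormal_def)
  then show ?case by blast
next
  case (insert b B)
  then obtain E where E: "orthonormal E" "span E = span B" by blast
  define w where "w = (\<Sum>e\<in>E. G b e *\<^sub>R e)"
  define d where "d = b - w"
  have w: "w \<in> span E" by (auto simp: w_def intro: span_sum span_scale span_base)
  have sp: "span (insert b B) = span (insert d E)"
  proof -
    have "span (insert b B) = span (insert b E)" by (simp only: span_insert E(2))
    also have "\<dots> = span (insert d E)"
      using w by (intro eq_span_insert_eq) (simp add: d_def)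
    finally show ?thesis .
  qed
  have orth: "G d f = 0" if "f \<in> E" for f
    using orthonormal_coeff [OF E(1) that] by (simp add: d_def w_def G_simps)
  show ?case
  proof (cases "d = 0")
    case True
    then show ?thesis using E sp by auto
  next
    case False
    define k where "k = 1 / sqrt (G d d)"
    have gd: "G d d > 0" using pos False by simp
    then have k: "k \<noteq> 0" "k * k * G d d = 1" by (simp_all add: k_def)
    have "orthonormal (insert (k *\<^sub>R d) E)"
    proof -
      have "G (k *\<^sub>R d) (k *\<^sub>R d) = 1" using k(2) by (simp add: G_simps)
      moreover have "G (k *\<^sub>R d) f = 0" "G f (k *\<^sub>R d) = 0" if "f \<in> E" for f
        using orth [OF that] sym [of f d] by (simp_all add: G_simps)
      ultimately show ?thesis using E(1) unfolding orthonormal_def by force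
    qed
    moreover have "span (insert (k *\<^sub>R d) E) = span (insert d E)"
    proof -
      have "d \<in> span (insert (k *\<^sub>R d) E)"
        using span_scale [OF span_base [of "k *\<^sub>R d" "insert (k *\<^sub>R d) E"], of "1 / k"] k(1) by simp
      moreover have "k *\<^sub>R d \<in> span (insert d E)" by (simp add: span_scale span_base)
      ultimately show ?thesis unfolding span_eq by (auto intro: span_base)
    qed
    ultimately show ?thesis using sp by blast
  qed
qed

lemma orthonormal_subspace_basis:
  assumes "subspace T"
  obtains E where "orthonormal E" "span E = T" "card E = dim T"
proof -
  obtain B where "B \<subseteq> T" "independent B" "T \<subseteq> span B" "card B = dim T"
    using basis_exists by blast
  moreover then have "finite B" "span B = T"
    using assms by (auto simp: independent_bound span_minimal subset_antisym)
  ultimately obtain E where "orthonormal E" "span E = T" using gram_schmidt by metis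
  then show thesis using that orthonormal_card by metis
qed

lemma orthonormal_basis_iff: "orthonormal_basis G E \<longleftrightarrow> orthonormal E \<and> span E = UNIV"
  using orthonormal_basis_finite [OF bil] by (auto simp: orthonormal_basis_def orthonormal_def)

lemma orthonormal_basis_exists: "\<exists>E. orthonormal_basis G E"
  using orthonormal_subspace_basis [OF subspace_UNIV] orthonormal_basis_iff by metis

lemma sharp_eqI: "(\<And>w. G v w = \<alpha> w) \<Longrightarrow> sharp G \<alpha> = v"
  unfolding sharp_def by (rule the_equality) (auto intro: eqI)

lemma G_sharp:
  assumes "linear \<alpha>"
  shows "G (sharp G \<alpha>) w = \<alpha> w"
proof -
  obtain E where E: "orthonormal E" "span E = UNIV"
    using orthonormal_basis_exists orthonormal_basis_iff by blast
  have "G (\<Sum>e\<in>E. \<alpha> e *\<^sub>R e) w = \<alpha> w" for w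
    using linear_expand [OF E(1) _ assms, of w] E(2)
    by (simp add: G_sum_left G_simps sym [of w] mult.commute)
  then show ?thesis using sharp_eqI by metis
qed

text \<open>
  \<open>endo_trace\<close> uses the inner product of the model space; linearity of \<open>L\<close> lets the two
  orthonormal expansions be exchanged, so that the trace may be computed with \<open>G\<close> instead.
\<close>

lemma endo_trace_orthonormal:
  assumes L: "linear L" and E: "orthonormal_basis G E"
  shows "endo_trace L = (\<Sum>e\<in>E. G (L e) e)"
proof -
  have "endo_trace L = (\<Sum>b\<in>Basis. \<Sum>e\<in>E. G (L b) e * (e \<bullet> b))"
    unfolding endo_trace_def
    by (subst orthonormal_basis_expand [OF bil E]) (simp add: inner_sum_left)
  also have "\<dots> = (\<Sum>e\<in>E. \<Sum>b\<in>Basis. (e \<bullet> b) * G (L b) e)"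
    by (subst sum.swap) (simp add: mult.commute)
  also have "\<dots> = (\<Sum>e\<in>E. G (L (\<Sum>b\<in>Basis. (e \<bullet> b) *\<^sub>R b)) e)"
    by (simp add: linear_sum [OF L] linear_scale [OF L] G_sum_left G_simps)
  finally show ?thesis by (simp add: euclidean_representation)
qed

end

section \<open>Curvature of a conformal product at a point\<close>

text \<open>
  The algebraic content of a conformal product at one point. In the application \<open>R\<close> and \<open>RD\<close> are
  the curvatures of the Levi-Civita connection and of the adapted Weyl connection, \<open>F\<close> is \<open>d\<theta>\<close>,
  \<open>B\<close> is \<open>\<nabla>\<theta> - \<theta> \<otimes> \<theta> + \<bar>\<theta>\<bar>\<^sup>2 g / 2\<close>, and \<open>b\<close> is the endomorphism that corresponds to
  the bilinear form \<open>B\<close>.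
\<close>

locale conformal_product_curvature = inner_form G
  for G :: "'v::euclidean_space \<Rightarrow> 'v \<Rightarrow> real" +
  fixes T1 T2 :: "'v set" and R RD :: "'v \<Rightarrow> 'v \<Rightarrow> 'v \<Rightarrow> 'v" and F B :: "'v \<Rightarrow> 'v \<Rightarrow> real"
    and b :: "'v \<Rightarrow> 'v"
  assumes sub: "subspace T1" "subspace T2"
    and split: "\<exists>v1\<in>T1. \<exists>v2\<in>T2. v = v1 + v2"
    and orth: "v1 \<in> T1 \<Longrightarrow> v2 \<in> T2 \<Longrightarrow> G v1 v2 = 0"
    and R_linear1: "linear (\<lambda>x. R x y z)" and R_linear3: "linear (R x y)"
    and R_skew12: "R y x z = - R x y z" and R_skew: "G (R x y z) z = 0"
    and RD_skew12: "RD y x z = - RD x y z"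
    and RD_bianchi: "RD x y z + RD y z x + RD z x y = 0"
    and RD_T1: "z \<in> T1 \<Longrightarrow> RD x y z \<in> T1" and RD_T2: "z \<in> T2 \<Longrightarrow> RD x y z \<in> T2"
    and F_linear: "linear (F x)" and F_skew: "F y x = - F x y"
    and B_bil: "bilinear B" and G_b: "G (b x) z = B x z"
    and RD_eq: "RD x y z = R x y z + F x y *\<^sub>R z + B x z *\<^sub>R y - B y z *\<^sub>R x
      - G y z *\<^sub>R b x + G x z *\<^sub>R b y"
begin

text \<open>
  The situation is symmetric in the two factors, so each statement about a block of an endomorphism
  need be proved for one of the two orders only.
\<close>

lemma swap: "conformal_product_curvature G T2 T1 R RD F B b"
proof (intro conformal_product_curvature.intro inner_form_axioms conformal_product_curvature_axioms.intro)
  show "\<exists>v1\<in>T2. \<exists>v2\<in>T1. v = v1 + v2" for v using split [of v] by (metis add.commute)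
  show "v1 \<in> T2 \<Longrightarrow> v2 \<in> T1 \<Longrightarrow> G v1 v2 = 0" for v1 v2 using orth sym by metis
qed (assumption | rule sub R_linear1 R_linear3 R_skew12 R_skew RD_skew12 RD_bianchi RD_T1 RD_T2
    F_linear F_skew B_bil G_b RD_eq)+

lemma B_linear: "linear (B x)" and B_linear1: "linear (\<lambda>x. B x z)"
  using B_bil by (simp_all add: bilinear_def)

lemma R_linear2: "linear (\<lambda>y. R x y z)"
  using linear_compose_neg [OF R_linear1] by (subst R_skew12)

lemma disjoint:
  assumes "v \<in> T1" "v \<in> T2"
  shows "v = 0"
  using orth [OF assms] pos [of v] by force

lemma orth': "v2 \<in> T2 \<Longrightarrow> v1 \<in> T1 \<Longrightarrow> G v2 v1 = 0"
  using orth sym by metis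

lemma in_T1_iff: "v \<in> T1 \<longleftrightarrow> (\<forall>w\<in>T2. G v w = 0)"
proof
  assume *: "\<forall>w\<in>T2. G v w = 0"
  obtain v1 v2 where v: "v1 \<in> T1" "v2 \<in> T2" "v = v1 + v2" using split by blast
  have "G v v2 = 0" using * v(2) by blast
  then have "G v2 v2 = 0" using orth [OF v(1,2)] by (simp add: v(3) G_simps)
  then have "v2 = 0" using pos by force
  then show "v \<in> T1" using v by simp
qed (simp add: orth)

lemma dim_split: "DIM('v) = dim T1 + dim T2"
proof -
  have "{x + y |x y. x \<in> T1 \<and> y \<in> T2} = UNIV" using split by blast
  moreover have "T1 \<inter> T2 = {0}"
    using disjoint sub by (auto dest: subspace_0)
  ultimately show ?thesis
    using dim_sums_Int [OF sub] by (simp add: dim_UNIV)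
qed

lemma R_skew34: "G (R x y z) w = - G (R x y w) z"
  using R_skew [of x y "z + w"] R_skew [of x y z] R_skew [of x y w]
  by (simp add: linear_add [OF R_linear3] G_simps)

text \<open>
  The curvature of a Weyl connection is skew up to the multiple \<open>F x y\<close> of the identity: \<open>R\<close> is skew
  and the terms with \<open>B\<close> cancel in pairs.
\<close>

lemma RD_trace34: "G (RD x y z) w + G (RD x y w) z = 2 * F x y * G z w"
  using R_skew34 [of x y z w] by (simp add: RD_eq G_simps G_b sym [of w z] sym [of y] sym [of x])

text \<open>
  The Bianchi identity expresses this vector, which lies in \<open>T2\<close>, as a sum of two vectors of \<open>T1\<close>.
\<close>

lemma RD_same_factor:
  assumes "x \<in> T1" "y \<in> T1" "z \<in> T2"
  shows "RD x y z = 0"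
proof (rule disjoint)
  show "RD x y z \<in> T2" using assms RD_T2 by blast
  have "RD x y z = - (RD y z x + RD z x y)"
    using RD_bianchi [of x y z] by (metis add.assoc eq_neg_iff_add_eq_0)
  then show "RD x y z \<in> T1"
    using assms RD_T1 sub(1) by (simp add: subspace_add subspace_neg subspace_diff)
qed

text \<open>
  A nonzero \<open>z\<close> in the other factor detects \<open>F x y\<close>, because \<open>RD x y z = F x y z\<close> up to a part
  orthogonal to \<open>z\<close>.
\<close>

lemma F_same_factor:
  assumes "x \<in> T1" "y \<in> T1" "z \<in> T2" "z \<noteq> 0"
  shows "F x y = 0"
  using RD_trace34 [of x y z z] RD_same_factor [OF assms(1-3)] pos [OF assms(4)]
  by (simp add: G_simps)

lemma RD_mixed_sym:
  assumes "x \<in> T2" "y \<in> T1" "z \<in> T1"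
  shows "RD x y z = RD x z y"
  using RD_bianchi [of x y z] RD_same_factor [OF assms(2,3,1)] RD_skew12 [of x z y]
  by (metis add.right_neutral add_right_cancel eq_neg_iff_add_eq_0)

text \<open>
  A Koszul-type trick: by the Bianchi identity \<open>G (RD x y z) v\<close> is symmetric in \<open>y\<close> and \<open>z\<close>, and it
  is skew in \<open>z\<close> and \<open>v\<close> up to a term with \<open>F\<close>. Together these two symmetries determine it by \<open>F\<close>.
\<close>

lemma RD_mixed_trace_term:
  assumes "x \<in> T2" "e \<in> T1" "v \<in> T1"
  shows "G (RD x e e) v = 2 * F x e * G e v - F x v * G e e"
  using RD_trace34 [of x e e v] RD_trace34 [of x v e e] RD_mixed_sym [OF assms(1,3,2)]
  by simp

context
  fixes E1 E2 :: "'v set"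
  assumes E1: "orthonormal E1" "span E1 = T1" and E2: "orthonormal E2" "span E2 = T2"
begin

lemma E_mem: "e \<in> E1 \<Longrightarrow> e \<in> T1" "e \<in> E2 \<Longrightarrow> e \<in> T2"
  using E1 E2 span_base by blast+

lemma E_norm: "e \<in> E1 \<Longrightarrow> G e e = 1" "e \<in> E2 \<Longrightarrow> G e e = 1"
  using E1 E2 by (auto simp: orthonormal_def)

lemma E_disjoint: "E1 \<inter> E2 = {}"
proof -
  have False if "e \<in> E1" "e \<in> E2" for e
    using E_mem that orth E_norm by (metis zero_neq_one)
  then show ?thesis by blast
qed

lemma E_basis: "orthonormal_basis G (E1 \<union> E2)"
proof -
  have "orthonormal (E1 \<union> E2)"
    using E1(1) E2(1) E_mem orth orth' E_disjoint unfolding orthonormal_def by force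
  moreover have "v \<in> span (E1 \<union> E2)" for v
  proof -
    obtain v1 v2 where "v1 \<in> T1" "v2 \<in> T2" "v = v1 + v2" using split by blast
    then show ?thesis
      using E1(2) E2(2) span_mono [of E1 "E1 \<union> E2"] span_mono [of E2 "E1 \<union> E2"]
      by (auto intro: span_add)
  qed
  ultimately show ?thesis by (auto simp: orthonormal_basis_iff)
qed

text \<open>
  This and the next lemma evaluate the two halves of the sum that gives the mixed Ricci curvature.
  Over the factor that contains \<open>v\<close>, the vectors \<open>RD x e e\<close> contribute a multiple of \<open>F x v\<close> by
  \<open>RD_mixed_trace_term\<close>, and the multiple of the identity by which \<open>RD\<close> and \<open>R\<close> differ contributes
  another. Over the factor that contains \<open>x\<close>, these terms are orthogonal to \<open>v\<close>. This asymmetry is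
  why \<open>F\<close> survives in the contraction of the Weyl tensor.
\<close>

lemma R_trace_T1:
  assumes "x \<in> T2" "v \<in> T1"
  shows "(\<Sum>e\<in>E1. G (R x e e) v) = (real (card E1) - 1) * (B x v - F x v)"
proof -
  have summand: "G (R x e e) v = F x e * G v e - F x v - G v e * B x e + B x v" if "e \<in> E1" for e
  proof -
    have e: "e \<in> T1" "G e e = 1" "G x e = 0" "G x v = 0"
      using that E_mem E_norm orth' assms by auto
    have "G (RD x e e) v = G (R x e e) v + F x e * G v e + B x e * G v e - B x v"
      using e by (simp add: RD_eq G_simps G_b sym [of e v])
    then show ?thesis
      using RD_mixed_trace_term [OF assms(1) e(1) assms(2)] e by (simp add: sym [of e v])
  qed
  have "(\<Sum>e\<in>E1. G v e * F x e) = F x v" "(\<Sum>e\<in>E1. G v e * B x e) = B x v"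
    using linear_expand [OF E1(1) _ F_linear] linear_expand [OF E1(1) _ B_linear] E1(2) assms(2)
    by (simp_all add: mult.commute)
  then have "(\<Sum>e\<in>E1. G (R x e e) v) = F x v - card E1 * F x v - B x v + card E1 * B x v"
    by (simp add: summand sum.distrib sum_subtractf mult.commute)
  then show ?thesis by (simp add: algebra_simps)
qed

lemma R_trace_T2:
  assumes "x \<in> T2" "v \<in> T1"
  shows "(\<Sum>e\<in>E2. G (R x e e) v) = (real (card E2) - 1) * B x v"
proof -
  have summand: "G (R x e e) v = B x v - G x e * B e v" if "e \<in> E2" for e
  proof -
    have e: "e \<in> T2" "G e e = 1" "G e v = 0" "G x v = 0" "G (RD x e e) v = 0"
      using that E_mem E_norm orth' assms RD_T2 by auto
    then show ?thesis by (simp add: RD_eq G_simps G_b)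
  qed
  have "(\<Sum>e\<in>E2. G x e * B e v) = B x v"
    using linear_expand [OF E2(1) _ B_linear1] E2(2) assms(1) by simp
  then show ?thesis by (simp add: summand sum_subtractf algebra_simps)
qed

end

definition ric :: "'v \<Rightarrow> 'v \<Rightarrow> real" where
  "ric y z = endo_trace (\<lambda>x. R x y z)"

text \<open>
  With \<open>s\<close> the scalar curvature, this is the Weyl tensor of a metric with curvature \<open>R\<close>.
\<close>

definition weyl :: "real \<Rightarrow> 'v \<Rightarrow> 'v \<Rightarrow> 'v \<Rightarrow> 'v" where
  "weyl s x y z = R x y z
     - (1 / (real DIM('v) - 2)) *\<^sub>R (ric y z *\<^sub>R x - ric x z *\<^sub>R y
         + G y z *\<^sub>R sharp G (ric x) - G x z *\<^sub>R sharp G (ric y))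
     + (s / ((real DIM('v) - 1) * (real DIM('v) - 2))) *\<^sub>R (G y z *\<^sub>R x - G x z *\<^sub>R y)"

lemma ric_orthonormal:
  assumes "orthonormal_basis G E"
  shows "ric x v = (\<Sum>e\<in>E. G (R x e e) v)"
proof -
  have "ric x v = (\<Sum>e\<in>E. G (R e x v) e)"
    unfolding ric_def by (rule endo_trace_orthonormal [OF R_linear1 assms])
  also have "\<dots> = (\<Sum>e\<in>E. G (R x e e) v)"
  proof (rule sum.cong [OF refl])
    show "G (R e x v) e = G (R x e e) v" for e
      using R_skew34 [of e x v e] R_skew12 [of x e e] by (simp add: G_simps)
  qed
  finally show ?thesis .
qed

lemma ric_bilinear: "bilinear ric"
proof -
  have "linear (\<lambda>x. f x \<bullet> b)" if "linear f" for f :: "'v \<Rightarrow> 'v" and b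
    using that by (intro linearI) (simp_all add: linear_add linear_scale inner_add_left)
  then show ?thesis
    unfolding bilinear_def ric_def endo_trace_def
    using R_linear2 R_linear3 by (intro conjI allI linear_compose_sum ballI) blast+
qed

lemma ric_linear1: "linear (\<lambda>x. ric x z)" and ric_linear2: "linear (ric x)"
  using ric_bilinear by (simp_all add: bilinear_def)

lemma G_sharp_ric: "G (sharp G (ric x)) z = ric x z"
  by (rule G_sharp [OF ric_linear2])

lemma sharp_ric_linear: "linear (\<lambda>x. sharp G (ric x))"
  by (intro linearI eqI)
    (simp_all add: G_sharp_ric G_simps linear_add [OF ric_linear1] linear_scale [OF ric_linear1])

lemma weyl_linear1: "linear (\<lambda>x. weyl s x y z)"
  unfolding weyl_def
  by (rule linearI)
    (simp_all add: G_simps linear_add [OF R_linear1] linear_scale [OF R_linear1]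
      linear_add [OF ric_linear1] linear_scale [OF ric_linear1]
      linear_add [OF sharp_ric_linear] linear_scale [OF sharp_ric_linear] algebra_simps)

lemma weyl_bilinear23: "bilinear (weyl s x)"
  unfolding bilinear_def weyl_def
  by (intro conjI allI linearI)
    (simp_all add: G_simps linear_add [OF R_linear2] linear_scale [OF R_linear2]
      linear_add [OF R_linear3] linear_scale [OF R_linear3]
      linear_add [OF ric_linear1] linear_scale [OF ric_linear1]
      linear_add [OF ric_linear2] linear_scale [OF ric_linear2]
      linear_add [OF sharp_ric_linear] linear_scale [OF sharp_ric_linear] algebra_simps)

text \<open>
  Let \<open>p\<close> and \<open>q\<close> be the ranks and \<open>n = p + q\<close>. In a basis adapted to the splitting, the contraction
  is the difference of the sums of \<open>weyl s x e e\<close> over the two factors. With \<open>r\<^sub>1\<close>, \<open>r\<^sub>2\<close> the two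
  halves of the mixed Ricci curvature, \<open>r\<^sub>1 = (p - 1) (B - F)\<close> and \<open>r\<^sub>2 = (q - 1) B\<close>, it equals
  \<open>r\<^sub>1 - r\<^sub>2 - (p - q) (r\<^sub>1 + r\<^sub>2) / (n - 2)\<close>, in which \<open>B\<close> cancels because
  \<open>n - 2 = (p - 1) + (q - 1)\<close>.
\<close>

lemma weyl_mixed_contraction:
  assumes E: "orthonormal_basis G E" and S: "linear S" "\<And>v. v \<in> T1 \<Longrightarrow> S v = v" "\<And>v. v \<in> T2 \<Longrightarrow> S v = - v"
    and n: "DIM('v) > 2" and xv: "x \<in> T2" "v \<in> T1"
  shows "G (\<Sum>e\<in>E. weyl s x e (S e)) v =
    - (2 * (real (dim T1) - 1) * (real (dim T2) - 1) / (real DIM('v) - 2)) * F x v"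
proof -
  obtain E1 where E1: "orthonormal E1" "span E1 = T1" "card E1 = dim T1"
    using orthonormal_subspace_basis sub(1) by blast
  obtain E2 where E2: "orthonormal E2" "span E2 = T2" "card E2 = dim T2"
    using orthonormal_subspace_basis sub(2) by blast
  note adapted = E1(1,2) E2(1,2)
  note mem = E_mem [OF adapted] and norm1 = E_norm [OF adapted]
  note basis = E_basis [OF adapted] and disj = E_disjoint [OF adapted]
  have fin: "finite E1" "finite E2" using E1 E2 by (auto simp: orthonormal_def)
  note dim = dim_split
  let ?n = "real DIM('v)" and ?p = "real (dim T1)" and ?q = "real (dim T2)"
  let ?r1 = "\<Sum>e\<in>E1. G (R x e e) v" and ?r2 = "\<Sum>e\<in>E2. G (R x e e) v"
  have G0: "G x v = 0" using xv orth' by blast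
  have ric: "ric x v = ?r1 + ?r2"
    using ric_orthonormal [OF basis] fin disj by (simp add: sum.union_disjoint)
  have bil_S: "bilinear (\<lambda>e f. weyl s x e (S f))"
    using weyl_bilinear23 [of s x] S(1) unfolding bilinear_def
    by (auto intro: linear_compose [unfolded o_def])
  have "(\<Sum>e\<in>E. weyl s x e (S e)) = (\<Sum>e\<in>E1 \<union> E2. weyl s x e (S e))"
    using orthonormal_basis_sum_unique [OF bil sym bil_S E basis] .
  also have "\<dots> = (\<Sum>e\<in>E1. weyl s x e (S e)) + (\<Sum>e\<in>E2. weyl s x e (S e))"
    using fin disj by (simp add: sum.union_disjoint)
  also have "(\<Sum>e\<in>E1. weyl s x e (S e)) = (\<Sum>e\<in>E1. weyl s x e e)"
    by (intro sum.cong) (simp_all add: S(2) mem)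
  also have "(\<Sum>e\<in>E2. weyl s x e (S e)) = (\<Sum>e\<in>E2. - weyl s x e e)"
    by (intro sum.cong) (simp_all add: S(3) mem bilinear_rneg [OF weyl_bilinear23])
  finally have K: "G (\<Sum>e\<in>E. weyl s x e (S e)) v =
      (\<Sum>e\<in>E1. G (weyl s x e e) v) - (\<Sum>e\<in>E2. G (weyl s x e e) v)"
    by (simp add: G_simps G_sum_left sum_negf)
  have summand1: "G (weyl s x e e) v = G (R x e e) v - (ric x v - G v e * ric x e) / (?n - 2)" if "e \<in> E1" for e
    using mem(1) [OF that] norm1(1) [OF that] orth' [OF xv(1)] G0
    by (simp add: weyl_def G_simps G_sharp_ric sym [of e v] diff_divide_distrib algebra_simps)
  have sum1: "(\<Sum>e\<in>E1. G v e * ric x e) = ric x v"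
    using linear_expand [OF E1(1) _ ric_linear2] E1(2) xv by simp
  have W1: "(\<Sum>e\<in>E1. G (weyl s x e e) v) = ?r1 - (?p - 1) * ric x v / (?n - 2)"
    by (simp add: summand1 sum_subtractf sum_divide_distrib [symmetric] sum1 E1(3) left_diff_distrib)
  have summand2: "G (weyl s x e e) v = G (R x e e) v - (ric x v - G x e * ric e v) / (?n - 2)" if "e \<in> E2" for e
    using mem(2) [OF that] norm1(2) [OF that] orth' [OF _ xv(2)] G0
    by (simp add: weyl_def G_simps G_sharp_ric diff_divide_distrib algebra_simps)
  have sum2: "(\<Sum>e\<in>E2. G x e * ric e v) = ric x v"
    using linear_expand [OF E2(1) _ ric_linear1] E2(2) xv by simp
  have W2: "(\<Sum>e\<in>E2. G (weyl s x e e) v) = ?r2 - (?q - 1) * ric x v / (?n - 2)"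
    by (simp add: summand2 sum_subtractf sum_divide_distrib [symmetric] sum2 E2(3) left_diff_distrib)
  have r: "?r1 = (?p - 1) * (B x v - F x v)" "?r2 = (?q - 1) * B x v"
    using R_trace_T1 [OF adapted xv] R_trace_T2 [OF adapted xv] E1(3) E2(3) by simp_all
  have n2: "?n - 2 = (?p - 1) + (?q - 1)" using dim by simp
  have alg: "(a * (X - Y) - a * (a * (X - Y) + c * X) / (a + c)) - (c * X - c * (a * (X - Y) + c * X) / (a + c))
      = - (2 * a * c / (a + c)) * Y" if "a + c \<noteq> 0" for a c X Y :: real
  proof -
    have "(a * (X - Y) - a * (a * (X - Y) + c * X) / (a + c)) - (c * X - c * (a * (X - Y) + c * X) / (a + c))
        = ((a * (X - Y) - c * X) * (a + c) - (a - c) * (a * (X - Y) + c * X)) / (a + c)"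
      using that by (simp add: diff_divide_distrib add_divide_distrib left_diff_distrib)
    also have "(a * (X - Y) - c * X) * (a + c) - (a - c) * (a * (X - Y) + c * X) = - (2 * a * c) * Y"
      by (simp add: algebra_simps)
    finally show ?thesis by simp
  qed
  show ?thesis
    unfolding K W1 W2 ric r n2 by (rule alg) (use dim n in auto)
qed

text \<open>
  The off-diagonal blocks of the contraction \<open>k\<close> are nonzero multiples of those of \<open>F\<close>, while the
  diagonal blocks of \<open>F\<close> vanish. Hence \<open>F = 0\<close> exactly when \<open>k\<close> is block diagonal, that is, preserves
  the eigenspaces of \<open>S\<close>.
\<close>

theorem F_zero_iff_contraction_splits:
  fixes s :: real
  assumes E: "orthonormal_basis G E" and S: "linear S" "\<And>v. v \<in> T1 \<Longrightarrow> S v = v" "\<And>v. v \<in> T2 \<Longrightarrow> S v = - v"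
    and ranks: "dim T1 \<ge> 2" "dim T2 \<ge> 2"
  defines "k \<equiv> \<lambda>x. \<Sum>e\<in>E. weyl s x e (S e)"
  shows "(\<forall>x y. F x y = 0) \<longleftrightarrow> k ` T1 \<subseteq> T1 \<and> k ` T2 \<subseteq> T2"
    and "(\<forall>x y. F x y = 0) \<longleftrightarrow> (\<forall>x. k (S x) = S (k x))"
proof -
  interpret sw: conformal_product_curvature G T2 T1 R RD F B b by (rule swap)
  have dims: "dim T1 \<ge> 2" "dim T2 \<ge> 2" "DIM('v) > 2" using ranks dim_split by auto
  let ?c = "2 * (real (dim T1) - 1) * (real (dim T2) - 1) / (real DIM('v) - 2)"
  have c: "?c \<noteq> 0" using dims by simp
  have k21: "G (k x) v = - ?c * F x v" if "x \<in> T2" "v \<in> T1" for x v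
    unfolding k_def by (rule weyl_mixed_contraction [OF E S dims(3) that])
  \<comment> \<open>Exchanging the factors replaces \<open>S\<close> by \<open>- S\<close>, which accounts for the opposite sign.\<close>
  have k12: "G (k x) v = ?c * F x v" if "x \<in> T1" "v \<in> T2" for x v
  proof -
    have "sw.weyl s = weyl s" by (simp add: fun_eq_iff sw.weyl_def weyl_def sw.ric_def ric_def)
    then have "G (\<Sum>e\<in>E. weyl s x e (- S e)) v =
        - (2 * (real (dim T2) - 1) * (real (dim T1) - 1) / (real DIM('v) - 2)) * F x v"
      using sw.weyl_mixed_contraction [OF E linear_compose_neg [OF S(1)] _ _ dims(3) that, of s] S(2,3)
      by simp
    also have "\<dots> = - ?c * F x v" by (simp only: mult_ac)
    finally have "G (\<Sum>e\<in>E. weyl s x e (- S e)) v = - ?c * F x v" .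
    then show ?thesis
      by (simp add: k_def bilinear_rneg [OF weyl_bilinear23] sum_negf G_simps)
  qed
  obtain t1 t2 where t: "t1 \<in> T1" "t1 \<noteq> 0" "t2 \<in> T2" "t2 \<noteq> 0"
    using dims(1,2) by (metis dim_eq_0 not_numeral_le_zero singleton_iff subsetI)
  have F0: "(\<forall>x y. F x y = 0) \<longleftrightarrow> (\<forall>x\<in>T1. \<forall>v\<in>T2. F x v = 0)"
  proof (intro iffI allI)
    fix x y assume *: "\<forall>x\<in>T1. \<forall>v\<in>T2. F x v = 0"
    obtain x1 x2 y1 y2 where xy: "x1 \<in> T1" "x2 \<in> T2" "x = x1 + x2" "y1 \<in> T1" "y2 \<in> T2" "y = y1 + y2"
      using split by metis
    have "F x1 y1 = 0" "F x2 y2 = 0" "F x1 y2 = 0" "F y1 x2 = 0"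
      using xy F_same_factor sw.F_same_factor t * by auto
    moreover have "F x2 y1 = 0"
      using F_skew [of x2 y1] \<open>F y1 x2 = 0\<close> by simp
    moreover have "F x y = F x1 y + F x2 y"
      using F_skew [of x y] F_skew [of x1 y] F_skew [of x2 y] linear_add [OF F_linear, of y x1 x2]
      unfolding xy(3) by linarith
    ultimately show "F x y = 0" by (simp add: xy(6) linear_add [OF F_linear])
  qed simp
  have pres: "k ` T1 \<subseteq> T1 \<longleftrightarrow> (\<forall>x\<in>T1. \<forall>v\<in>T2. F x v = 0)"
    using k12 c by (auto simp: in_T1_iff image_subset_iff)
  moreover have "k ` T2 \<subseteq> T2 \<longleftrightarrow> (\<forall>x\<in>T2. \<forall>v\<in>T1. F x v = 0)"
    using k21 c by (auto simp: sw.in_T1_iff image_subset_iff)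
  ultimately show iff1: "(\<forall>x y. F x y = 0) \<longleftrightarrow> k ` T1 \<subseteq> T1 \<and> k ` T2 \<subseteq> T2"
    using F0 by metis
  have k_lin: "linear k" unfolding k_def by (intro linear_compose_sum weyl_linear1 ballI)
  have "k ` T1 \<subseteq> T1 \<and> k ` T2 \<subseteq> T2 \<longleftrightarrow> (\<forall>x. k (S x) = S (k x))"
  proof safe
    fix x assume *: "k ` T1 \<subseteq> T1" "k ` T2 \<subseteq> T2"
    obtain x1 x2 where x: "x1 \<in> T1" "x2 \<in> T2" "x = x1 + x2" using split by blast
    then have "k x1 \<in> T1" "k x2 \<in> T2" using * by auto
    then show "k (S x) = S (k x)"
      using x S by (simp add: linear_add [OF k_lin] linear_add [OF S(1)] linear_diff [OF k_lin])
  next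
    have fixed1: "y \<in> T1" if "S y = y" for y
    proof -
      obtain y1 y2 where y: "y1 \<in> T1" "y2 \<in> T2" "y = y1 + y2" using split by blast
      then have "y2 = - y2" using that S by (simp add: linear_add [OF S(1)])
      then show ?thesis using y by (simp add: eq_neg_iff_add_eq_0 flip: scaleR_2)
    qed
    have fixed2: "y \<in> T2" if "S y = - y" for y
    proof -
      obtain y1 y2 where y: "y1 \<in> T1" "y2 \<in> T2" "y = y1 + y2" using split by blast
      then have "y1 = - y1" using that S by (simp add: linear_add [OF S(1)])
      then show ?thesis using y by (simp add: eq_neg_iff_add_eq_0 flip: scaleR_2)
    qed
    assume *: "\<forall>x. k (S x) = S (k x)"
    show "k x \<in> T1" if "x \<in> T1" for x using * that S(2) by (intro fixed1) metis
    show "k x \<in> T2" if "x \<in> T2" for x using * that S(3) by (intro fixed2) (metis linear_neg [OF k_lin])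
  qed
  then show "(\<forall>x y. F x y = 0) \<longleftrightarrow> (\<forall>x. k (S x) = S (k x))" using iff1 by simp
qed

end

section \<open>Curvature of a connection in a chart\<close>

locale chart_connection =
  fixes N :: "'v::euclidean_space set" and \<Gamma> :: "'v \<Rightarrow> 'v \<Rightarrow> 'v \<Rightarrow> 'v"
  assumes N: "open N"
    and bilinear: "u \<in> N \<Longrightarrow> bilinear (\<Gamma> u)"
    and smooth: "smooth_on N (\<lambda>u. \<Gamma> u v w)"
begin

lemma differentiable: "u \<in> N \<Longrightarrow> (\<lambda>u. \<Gamma> u v w) differentiable at u"
  using smooth_on_differentiable_at [OF smooth N] .

lemma linear_left: "u \<in> N \<Longrightarrow> linear (\<lambda>v. \<Gamma> u v w)" and linear_right: "u \<in> N \<Longrightarrow> linear (\<Gamma> u v)"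
  using bilinear by (simp_all add: bilinear_def)

lemma cov_const: "cov \<Gamma> (\<lambda>_. x) Z = (\<lambda>u. dderiv Z u x + \<Gamma> u x (Z u))"
  by (simp add: fun_eq_iff cov_def)

lemma riem_coords:
  assumes "u \<in> N"
  shows "riem \<Gamma> u x y z = dderiv (\<lambda>u. \<Gamma> u y z) u x - dderiv (\<lambda>u. \<Gamma> u x z) u y
    + \<Gamma> u x (\<Gamma> u y z) - \<Gamma> u y (\<Gamma> u x z)"
  using bilinear_lzero [OF bilinear [OF assms]]
  by (simp add: riem_def curvature_def cov_const lie_bracket_def) (simp add: cov_def lie_bracket_def)

lemma riem_skew12: "u \<in> N \<Longrightarrow> riem \<Gamma> u y x z = - riem \<Gamma> u x y z"
  by (simp add: riem_coords)

lemma riem_bianchi: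
  assumes "u \<in> N" and sym: "\<And>u x y. u \<in> N \<Longrightarrow> \<Gamma> u x y = \<Gamma> u y x"
  shows "riem \<Gamma> u x y z + riem \<Gamma> u y z x + riem \<Gamma> u z x y = 0"
proof -
  have "dderiv (\<lambda>u. \<Gamma> u x y) u z = dderiv (\<lambda>u. \<Gamma> u y x) u z" for x y z
    using assms by (intro dderiv_cong [OF differentiable N]) auto
  then show ?thesis
    using assms(1) sym [OF assms(1), of x y] sym [OF assms(1), of y z] sym [OF assms(1), of z x]
    by (simp add: riem_coords)
qed

lemma dderiv_linear_left:
  assumes u: "u \<in> N"
  shows "linear (\<lambda>v. dderiv (\<lambda>u. \<Gamma> u v w) u x)"
proof (rule linearI)
  have "dderiv (\<lambda>u. \<Gamma> u (v + v') w) u x = dderiv (\<lambda>u. \<Gamma> u v w + \<Gamma> u v' w) u x" for v v'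
    using u by (intro dderiv_cong [OF differentiable N]) (auto simp: linear_add [OF linear_left])
  then show "dderiv (\<lambda>u. \<Gamma> u (v + v') w) u x = dderiv (\<lambda>u. \<Gamma> u v w) u x + dderiv (\<lambda>u. \<Gamma> u v' w) u x"
    for v v'
    using dderiv_unique [OF has_derivative_add [OF has_derivative_dderiv has_derivative_dderiv],
        OF differentiable differentiable, OF u u] by simp
  have "dderiv (\<lambda>u. \<Gamma> u (r *\<^sub>R v) w) u x = dderiv (\<lambda>u. r *\<^sub>R \<Gamma> u v w) u x" for r v
    using u by (intro dderiv_cong [OF differentiable N]) (auto simp: linear_scale [OF linear_left])
  then show "dderiv (\<lambda>u. \<Gamma> u (r *\<^sub>R v) w) u x = r *\<^sub>R dderiv (\<lambda>u. \<Gamma> u v w) u x" for r v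
    using dderiv_unique [OF has_derivative_scaleR_right [OF has_derivative_dderiv], OF differentiable, OF u]
    by simp
qed

lemma dderiv_linear_right:
  assumes u: "u \<in> N"
  shows "linear (\<lambda>w. dderiv (\<lambda>u. \<Gamma> u v w) u x)"
proof -
  interpret flip: chart_connection N "\<lambda>u v w. \<Gamma> u w v"
    by unfold_locales (use N linear_left linear_right smooth in \<open>auto simp: bilinear_def\<close>)
  show ?thesis by (rule flip.dderiv_linear_left [OF u])
qed

lemma riem_linear1:
  assumes u: "u \<in> N"
  shows "linear (\<lambda>x. riem \<Gamma> u x y z)"
  unfolding riem_coords [OF u]
  by (rule linearI)
    (simp_all add: linear_add [OF dderiv_linear [OF differentiable [OF u]]]
      linear_scale [OF dderiv_linear [OF differentiable [OF u]]]
      linear_add [OF dderiv_linear_left [OF u]] linear_scale [OF dderiv_linear_left [OF u]]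
      linear_add [OF linear_left [OF u]] linear_scale [OF linear_left [OF u]]
      linear_add [OF linear_right [OF u]] linear_scale [OF linear_right [OF u]] algebra_simps)

lemma riem_linear3:
  assumes u: "u \<in> N"
  shows "linear (riem \<Gamma> u x y)"
  unfolding riem_coords [OF u]
  by (rule linearI)
    (simp_all add: riem_coords [OF u]
      linear_add [OF dderiv_linear_right [OF u]] linear_scale [OF dderiv_linear_right [OF u]]
      linear_add [OF linear_right [OF u]] linear_scale [OF linear_right [OF u]] algebra_simps)

lemma smooth_on_cov:
  assumes "open N'" "N' \<subseteq> N" "smooth_on N' Z"
  shows "smooth_on N' (cov \<Gamma> (\<lambda>_. x) Z)"
proof -
  have "smooth_on N' (\<lambda>u. \<Gamma> u x (Z u))"
    by (rule smooth_on_apply_linear [where T = "\<lambda>u. \<Gamma> u x", OF assms(1) _ _ assms(3)])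
      (use assms in \<open>auto intro: linear_right smooth_on_subset [OF smooth]\<close>)
  then show ?thesis
    unfolding cov_const by (rule smooth_on_add [OF assms(1) smooth_on_dderiv [OF assms(3)]])
qed

text \<open>
  The left-hand side extends \<open>Z u\<close> by a constant field; the two sides differ by second derivatives of
  \<open>Z\<close>, which commute. The bracket term of the curvature is absent because the first two fields are
  constant.
\<close>

lemma riem_tensorial:
  assumes N': "open N'" "N' \<subseteq> N" "u \<in> N'" and Z: "smooth_on N' Z"
  shows "riem \<Gamma> u x y (Z u) = cov \<Gamma> (\<lambda>_. x) (cov \<Gamma> (\<lambda>_. y) Z) u - cov \<Gamma> (\<lambda>_. y) (cov \<Gamma> (\<lambda>_. x) Z) u"
proof -
  have u: "u \<in> N" using N' by auto
  have second: "cov \<Gamma> (\<lambda>_. x) (cov \<Gamma> (\<lambda>_. y) Z) u =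
      dderiv (\<lambda>u. dderiv Z u y) u x + dderiv (\<lambda>v. \<Gamma> v y (Z u)) u x + \<Gamma> u y (dderiv Z u x)
      + \<Gamma> u x (dderiv Z u y) + \<Gamma> u x (\<Gamma> u y (Z u))" for x y
  proof -
    have "smooth_on N' (\<lambda>u. \<Gamma> u y (Z u))"
      by (rule smooth_on_apply_linear [where T = "\<lambda>u. \<Gamma> u y", OF N'(1) _ _ Z])
        (use N' in \<open>auto intro: linear_right smooth_on_subset [OF smooth]\<close>)
    then have d: "(\<lambda>u. \<Gamma> u y (Z u)) differentiable at u"
      by (rule smooth_on_differentiable_at [OF _ N'(1,3)])
    have "dderiv (\<lambda>u. dderiv Z u y + \<Gamma> u y (Z u)) u x =
        dderiv (\<lambda>u. dderiv Z u y) u x + dderiv (\<lambda>u. \<Gamma> u y (Z u)) u x"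
      by (rule dderiv_unique, rule has_derivative_add [OF has_derivative_dderiv has_derivative_dderiv],
          rule smooth_on_differentiable_at [OF smooth_on_dderiv [OF Z] N'(1,3)], rule d)
    moreover have "dderiv (\<lambda>u. \<Gamma> u y (Z u)) u x =
        dderiv (\<lambda>v. \<Gamma> v y (Z u)) u x + \<Gamma> u y (dderiv Z u x)"
      using smooth_on_differentiable_at [OF Z N'(1,3)]
      by (intro dderiv_apply_linear [where T = "\<lambda>u. \<Gamma> u y", OF N u linear_right differentiable [OF u]])
    ultimately show ?thesis
      by (simp add: cov_const linear_add [OF linear_right [OF u]])
  qed
  show ?thesis
    using mixed_partials_commute [OF Z N'(1,3), of x y]
    by (simp add: second riem_coords [OF u])
qed

text \<open>
  A parallel distribution is invariant under the curvature. As a constant extension of a vector of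
  \<open>T u\<close> need not stay in \<open>T\<close>, the curvature is evaluated on a local frame of \<open>T\<close>, whose iterated
  covariant derivatives stay in \<open>T\<close>; linearity does the rest.
\<close>

lemma riem_preserves:
  assumes pres: "\<And>N' X Y u. open N' \<Longrightarrow> N' \<subseteq> N \<Longrightarrow> smooth_on N' X \<Longrightarrow> smooth_on N' Y \<Longrightarrow>
      (\<forall>u\<in>N'. Y u \<in> T u) \<Longrightarrow> u \<in> N' \<Longrightarrow> cov \<Gamma> X Y u \<in> T u"
    and T: "subspace (T u)"
    and N': "open N'" "N' \<subseteq> N" "u \<in> N'"
    and F: "\<And>i. i < r \<Longrightarrow> smooth_on N' (F i)" "\<And>x. x \<in> N' \<Longrightarrow> T x = span ((\<lambda>i. F i x) ` {..<r})"
    and z: "z \<in> T u"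
  shows "riem \<Gamma> u x y z \<in> T u"
proof -
  have u: "u \<in> N" using N' by auto
  have frame: "riem \<Gamma> u x y (F i u) \<in> T u" if i: "i < r" for i
  proof -
    have F_in: "\<forall>x\<in>N'. F i x \<in> T x" using F(2) i by (auto intro: span_base)
    have cov_in: "cov \<Gamma> (\<lambda>_. x) (F i) v \<in> T v" if "v \<in> N'" for x v
      by (rule pres [OF N'(1,2) smooth_on_const F(1) [OF i] F_in that])
    have "cov \<Gamma> (\<lambda>_. x) (cov \<Gamma> (\<lambda>_. y) (F i)) u \<in> T u" for x y
      by (rule pres [OF N'(1,2) smooth_on_const smooth_on_cov [OF N'(1,2) F(1) [OF i]] _ N'(3)])
        (use cov_in in blast)
    then show ?thesis
      unfolding riem_tensorial [OF N' F(1) [OF i]] using T by (intro subspace_diff)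
  qed
  have "span ((\<lambda>i. F i u) ` {..<r}) \<subseteq> {z. riem \<Gamma> u x y z \<in> T u}"
    using frame linear_subspace_vimage [OF riem_linear3 [OF u] T, of x y]
    by (intro span_minimal) (auto simp: vimage_def)
  then show ?thesis using z F(2) [OF N'(3)] by blast
qed

end

section \<open>Weyl connections in a chart\<close>

text \<open>
  \<open>\<Gamma>\<close> and \<open>\<Delta>\<close> are the Christoffel symbols of the Levi-Civita connection and of a Weyl connection with
  Lee form \<open>\<theta>\<close>. Symmetry and metric compatibility are stated for constant fields, which determine
  them because both are tensorial conditions.
\<close>

locale chart_weyl_connection =
  LC: chart_connection N \<Gamma> + W: chart_connection N \<Delta>
  for N :: "'v::euclidean_space set" and \<Gamma> \<Delta> :: "'v \<Rightarrow> 'v \<Rightarrow> 'v \<Rightarrow> 'v" +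
  fixes g :: "'v \<Rightarrow> 'v \<Rightarrow> 'v \<Rightarrow> real" and \<theta> :: "'v \<Rightarrow> 'v \<Rightarrow> real"
  assumes metric: "u \<in> N \<Longrightarrow> inner_form (g u)"
    and metric_smooth: "smooth_on N (\<lambda>u. g u v w)"
    and form_linear: "u \<in> N \<Longrightarrow> linear (\<theta> u)"
    and form_smooth: "smooth_on N (\<lambda>u. \<theta> u v)"
    and LC_sym: "u \<in> N \<Longrightarrow> \<Gamma> u x y = \<Gamma> u y x"
    and LC_compat: "u \<in> N \<Longrightarrow> dderiv (\<lambda>u. g u y z) u x = g u (\<Gamma> u x y) z + g u y (\<Gamma> u x z)"
    and weyl: "u \<in> N \<Longrightarrow> \<Delta> u x y =
      \<Gamma> u x y + \<theta> u y *\<^sub>R x + \<theta> u x *\<^sub>R y - g u x y *\<^sub>R sharp (g u) (\<theta> u)"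
begin

lemmas N = LC.N

lemma g_sym: "u \<in> N \<Longrightarrow> g u x y = g u y x"
  using inner_form.sym [OF metric] .

lemma g_linear_left: "u \<in> N \<Longrightarrow> linear (\<lambda>v. g u v w)"
  by (rule inner_form.linear_left [OF metric])

lemma g_linear_right: "u \<in> N \<Longrightarrow> linear (g u v)"
  by (rule inner_form.linear_right [OF metric])

lemma form_differentiable: "u \<in> N \<Longrightarrow> (\<lambda>u. \<theta> u v) differentiable at u"
  by (rule smooth_on_differentiable_at [OF form_smooth LC.N])

lemma metric_differentiable: "u \<in> N \<Longrightarrow> (\<lambda>u. g u v w) differentiable at u"
  by (rule smooth_on_differentiable_at [OF metric_smooth LC.N])

text \<open>
  Compatibility with the metric for constant fields implies it for fields that are merely
  differentiable; this is applied to \<open>Y = \<Gamma> y z\<close> and to the metric dual of the Lee form.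
\<close>

lemma metric_leibniz:
  assumes u: "u \<in> N" and Y: "Y differentiable at u"
  shows "dderiv (\<lambda>v. g v (Y v) z) u x = g u (dderiv Y u x + \<Gamma> u x (Y u)) z + g u (Y u) (\<Gamma> u x z)"
proof -
  have "dderiv (\<lambda>v. g v (Y v) z) u x = dderiv (\<lambda>v. g v (Y u) z) u x + g u (dderiv Y u x) z"
    by (rule dderiv_apply_linear [where T = "\<lambda>v w. g v w z", OF N u g_linear_left
        metric_differentiable [OF u] Y])
  then show ?thesis using u by (simp add: LC_compat linear_add [OF g_linear_left])
qed

text \<open>
  Differentiating \<open>g z z\<close> twice and using compatibility each time, the commutator of the two
  derivatives is \<open>2 g (R x y z) z\<close>; it vanishes because mixed partial derivatives commute.
\<close>

lemma riem_metric_skew: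
  assumes u: "u \<in> N"
  shows "g u (riem \<Gamma> u x y z) z = 0"
proof -
  let ?h = "\<lambda>u. g u z z"
  have dh: "dderiv ?h v y = 2 * g v (\<Gamma> v y z) z" if "v \<in> N" for v y
    using that g_sym [OF that, of z] by (simp add: LC_compat)
  have second: "dderiv (\<lambda>v. dderiv ?h v y) u x =
      2 * (g u (dderiv (\<lambda>v. \<Gamma> v y z) u x + \<Gamma> u x (\<Gamma> u y z)) z + g u (\<Gamma> u y z) (\<Gamma> u x z))" for x y
  proof -
    have d: "(\<lambda>v. g v (\<Gamma> v y z) z) differentiable at u"
      using smooth_on_apply_linear [where T = "\<lambda>v w. g v w z", OF N g_linear_left metric_smooth LC.smooth] N u
      by (rule smooth_on_differentiable_at)
    have "dderiv (\<lambda>v. dderiv ?h v y) u x = dderiv (\<lambda>v. 2 * g v (\<Gamma> v y z) z) u x"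
      using smooth_on_differentiable_at [OF smooth_on_dderiv [OF metric_smooth] N u] N u dh
      by (rule dderiv_cong)
    also have "\<dots> = 2 * dderiv (\<lambda>v. g v (\<Gamma> v y z) z) u x"
      by (rule dderiv_unique, rule has_derivative_mult_right, rule has_derivative_dderiv [OF d])
    finally show ?thesis using metric_leibniz [OF u LC.differentiable [OF u]] by simp
  qed
  have "dderiv (\<lambda>v. dderiv ?h v y) u x = dderiv (\<lambda>v. dderiv ?h v x) u y"
    by (rule mixed_partials_commute [OF metric_smooth N u])
  then show ?thesis
    unfolding second LC.riem_coords [OF u] using g_sym [OF u, of "\<Gamma> u y z" "\<Gamma> u x z"]
    by (simp add: linear_add [OF g_linear_left [OF u]] linear_diff [OF g_linear_left [OF u]])
qed

definition \<xi> :: "'v \<Rightarrow> 'v" where "\<xi> u = sharp (g u) (\<theta> u)"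

lemma g_\<xi>: "u \<in> N \<Longrightarrow> g u (\<xi> u) w = \<theta> u w"
  unfolding \<xi>_def by (rule inner_form.G_sharp [OF metric form_linear])

text \<open>
  Taking both arguments equal to \<open>v\<close> in the Weyl formula gives
  \<open>g(v,v) \<xi> = \<Gamma>(v,v) + 2 \<theta>(v) v - \<Delta>(v,v)\<close>, which displays \<open>\<xi>\<close> as a smooth field divided by a
  positive smooth function.
\<close>

lemma \<xi>_differentiable:
  assumes u: "u \<in> N"
  shows "\<xi> differentiable at u"
proof -
  obtain v :: 'v where v: "v \<noteq> 0" using nonzero_Basis nonempty_Basis by blast
  let ?f = "\<lambda>u. inverse (g u v v) *\<^sub>R (\<Gamma> u v v + \<theta> u v *\<^sub>R v + \<theta> u v *\<^sub>R v - \<Delta> u v v)"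
  have gv: "g u v v \<noteq> 0" if "u \<in> N" for u using inner_form.pos [OF metric [OF that] v] by simp
  have "?f differentiable at u"
    by (intro differentiable_scaleR differentiable_inverse differentiable_add differentiable_diff
        differentiable_const metric_differentiable form_differentiable LC.differentiable
        W.differentiable u gv)
  then obtain f' where "(?f has_derivative f') (at u)" by (auto simp: differentiable_def)
  moreover have "?f v' = \<xi> v'" if "v' \<in> N" for v'
    using gv [OF that] by (simp add: weyl [OF that] \<xi>_def)
  ultimately have "(\<xi> has_derivative f') (at u)"
    using has_derivative_transform_within_open [OF _ N u] by blast
  then show ?thesis by (auto simp: differentiable_def)
qed

lemma \<Delta>_sym: "u \<in> N \<Longrightarrow> \<Delta> u x y = \<Delta> u y x"
  by (simp add: weyl LC_sym [of u x] g_sym [of u x] add.commute add.left_commute)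

text \<open>
  In invariant terms \<open>\<beta> = \<nabla>\<theta> - \<theta> \<otimes> \<theta> + \<bar>\<theta>\<bar>\<^sup>2 g / 2\<close>, since \<open>\<theta> \<xi> = \<bar>\<theta>\<bar>\<^sup>2\<close>;
  \<open>\<beta>'\<close> is the endomorphism \<open>\<nabla>\<xi> - \<theta> \<otimes> \<xi> + \<bar>\<theta>\<bar>\<^sup>2 Id / 2\<close>, which corresponds to it under
  the metric.
\<close>

definition \<beta> :: "'v \<Rightarrow> 'v \<Rightarrow> 'v \<Rightarrow> real" where
  "\<beta> u x z = dderiv (\<lambda>v. \<theta> v z) u x - \<theta> u (\<Gamma> u x z) - \<theta> u x * \<theta> u z + \<theta> u (\<xi> u) / 2 * g u x z"

definition \<beta>' :: "'v \<Rightarrow> 'v \<Rightarrow> 'v" where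
  "\<beta>' u x = dderiv \<xi> u x + \<Gamma> u x (\<xi> u) - \<theta> u x *\<^sub>R \<xi> u + (\<theta> u (\<xi> u) / 2) *\<^sub>R x"

lemma g_\<beta>':
  assumes u: "u \<in> N"
  shows "g u (\<beta>' u x) z = \<beta> u x z"
proof -
  have "dderiv (\<lambda>v. g v (\<xi> v) z) u x = dderiv (\<lambda>v. \<theta> v z) u x"
    by (rule dderiv_cong [OF form_differentiable [OF u] N u, symmetric]) (simp add: g_\<xi>)
  then show ?thesis
    unfolding \<beta>_def \<beta>'_def using metric_leibniz [OF u \<xi>_differentiable [OF u], of z x] u
    by (simp add: linear_add [OF g_linear_left] linear_diff [OF g_linear_left]
        linear_scale [OF g_linear_left] g_\<xi>)
qed

lemma dderiv_\<Delta>: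
  assumes u: "u \<in> N"
  shows "dderiv (\<lambda>v. \<Delta> v y z) u x = dderiv (\<lambda>v. \<Gamma> v y z) u x + dderiv (\<lambda>v. \<theta> v z) u x *\<^sub>R y
    + dderiv (\<lambda>v. \<theta> v y) u x *\<^sub>R z - (g u (\<Gamma> u x y) z + g u y (\<Gamma> u x z)) *\<^sub>R \<xi> u
    - g u y z *\<^sub>R dderiv \<xi> u x"
proof -
  have "((\<lambda>v. \<Gamma> v y z + \<theta> v z *\<^sub>R y + \<theta> v y *\<^sub>R z - g v y z *\<^sub>R \<xi> v) has_derivative
     (\<lambda>x. dderiv (\<lambda>v. \<Gamma> v y z) u x + dderiv (\<lambda>v. \<theta> v z) u x *\<^sub>R y
    + dderiv (\<lambda>v. \<theta> v y) u x *\<^sub>R z - (g u y z *\<^sub>R dderiv \<xi> u x + dderiv (\<lambda>v. g v y z) u x *\<^sub>R \<xi> u))) (at u)"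
    by (intro has_derivative_diff has_derivative_add has_derivative_scaleR has_derivative_scaleR_left
        has_derivative_dderiv \<xi>_differentiable metric_differentiable form_differentiable
        LC.differentiable u)
  then have "((\<lambda>v. \<Delta> v y z) has_derivative
     (\<lambda>x. dderiv (\<lambda>v. \<Gamma> v y z) u x + dderiv (\<lambda>v. \<theta> v z) u x *\<^sub>R y
    + dderiv (\<lambda>v. \<theta> v y) u x *\<^sub>R z - (g u y z *\<^sub>R dderiv \<xi> u x + dderiv (\<lambda>v. g v y z) u x *\<^sub>R \<xi> u))) (at u)"
    by (rule has_derivative_transform_within_open [OF _ N u]) (simp add: weyl \<xi>_def)
  then show ?thesis using u by (simp add: dderiv_unique LC_compat)
qed

text \<open>
  The difference \<open>\<Delta> - \<Gamma>\<close> enters the curvature through its covariant derivative, which gives \<open>d\<theta>\<close>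
  and the terms with \<open>\<nabla>\<theta>\<close>, and through a commutator of its values, which gives the terms
  quadratic in \<open>\<theta>\<close> that complete \<open>\<nabla>\<theta>\<close> to \<open>\<beta>\<close>.
\<close>

lemma riem_weyl:
  assumes u: "u \<in> N"
  shows "riem \<Delta> u x y z = riem \<Gamma> u x y z + (dderiv (\<lambda>v. \<theta> v y) u x - dderiv (\<lambda>v. \<theta> v x) u y) *\<^sub>R z
    + \<beta> u x z *\<^sub>R y - \<beta> u y z *\<^sub>R x - g u y z *\<^sub>R \<beta>' u x + g u x z *\<^sub>R \<beta>' u y"
proof -
  \<comment> \<open>Halving \<open>\<theta> \<xi>\<close> first leaves an identity with integer coefficients.\<close>
  define \<kappa> where "\<kappa> = \<theta> u (\<xi> u) / 2"
  have \<kappa>: "\<theta> u (\<xi> u) = \<kappa> + \<kappa>" "\<theta> u (\<xi> u) / 2 = \<kappa>" by (simp_all add: \<kappa>_def)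
  have w: "\<Delta> u x y = \<Gamma> u x y + \<theta> u y *\<^sub>R x + \<theta> u x *\<^sub>R y - g u x y *\<^sub>R \<xi> u" for x y
    using weyl [OF u] by (simp add: \<xi>_def)
  note lin = linear_add [OF form_linear [OF u]] linear_diff [OF form_linear [OF u]] linear_scale [OF form_linear [OF u]]
    linear_add [OF g_linear_right [OF u]] linear_diff [OF g_linear_right [OF u]] linear_scale [OF g_linear_right [OF u]]
    linear_add [OF LC.linear_right [OF u]] linear_diff [OF LC.linear_right [OF u]] linear_scale [OF LC.linear_right [OF u]]
  have gx: "g u x (\<xi> u) = \<theta> u x" for x using g_\<xi> [OF u] g_sym [OF u] by metis
  show ?thesis
    unfolding W.riem_coords [OF u] LC.riem_coords [OF u] dderiv_\<Delta> [OF u] \<beta>_def \<beta>'_def \<kappa>(2)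
    unfolding w lin gx \<kappa>(1) g_sym [OF u, of "\<Gamma> u x y"] g_sym [OF u, of "\<Gamma> u y x"] LC_sym [OF u, of y x]
      g_sym [OF u, of y x]
    by (simp add: algebra_simps)
      (simp only: mult_2 mult_2_right distrib_left scaleR_add_left add_ac)
qed

lemma dderiv_form_linear:
  assumes u: "u \<in> N"
  shows "linear (\<lambda>z. dderiv (\<lambda>v. \<theta> v z) u x)"
proof -
  have "dderiv (\<lambda>v. \<theta> v z) u x = dderiv (\<lambda>v. g v (\<xi> v) z) u x" for z
    by (rule dderiv_cong [OF form_differentiable [OF u] N u]) (simp add: g_\<xi>)
  then show ?thesis
    by (intro linearI)
      (simp_all add: metric_leibniz [OF u \<xi>_differentiable [OF u]]
        linear_add [OF g_linear_right [OF u]] linear_scale [OF g_linear_right [OF u]]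
        linear_add [OF LC.linear_right [OF u]] linear_scale [OF LC.linear_right [OF u]] algebra_simps)
qed

lemma \<beta>_bilinear: "u \<in> N \<Longrightarrow> bilinear (\<beta> u)"
  unfolding bilinear_def \<beta>_def
  by (intro conjI allI linearI)
    (simp_all add: linear_add [OF form_linear] linear_scale [OF form_linear]
      linear_add [OF g_linear_right] linear_scale [OF g_linear_right]
      linear_add [OF g_linear_left] linear_scale [OF g_linear_left]
      linear_add [OF LC.linear_right] linear_scale [OF LC.linear_right]
      linear_add [OF LC.linear_left] linear_scale [OF LC.linear_left]
      linear_add [OF dderiv_form_linear] linear_scale [OF dderiv_form_linear]
      linear_add [OF dderiv_linear [OF form_differentiable]]
      linear_scale [OF dderiv_linear [OF form_differentiable]] algebra_simps)

lemma conformal_product_curvatureI: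
  assumes u: "u \<in> N"
    and sub: "subspace T1" "subspace T2"
    and split: "\<And>v. \<exists>v1\<in>T1. \<exists>v2\<in>T2. v = v1 + v2"
    and orth: "\<And>v1 v2. v1 \<in> T1 \<Longrightarrow> v2 \<in> T2 \<Longrightarrow> g u v1 v2 = 0"
    and pres: "\<And>x y z. z \<in> T1 \<Longrightarrow> riem \<Delta> u x y z \<in> T1" "\<And>x y z. z \<in> T2 \<Longrightarrow> riem \<Delta> u x y z \<in> T2"
  shows "conformal_product_curvature (g u) T1 T2 (riem \<Gamma> u) (riem \<Delta> u)
    (\<lambda>x y. dderiv (\<lambda>v. \<theta> v y) u x - dderiv (\<lambda>v. \<theta> v x) u y) (\<beta> u) (\<beta>' u)"
proof (intro conformal_product_curvature.intro metric [OF u] conformal_product_curvature_axioms.intro)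
  show "linear (\<lambda>y. dderiv (\<lambda>v. \<theta> v y) u x - dderiv (\<lambda>v. \<theta> v x) u y)" for x
    by (intro linear_compose_sub dderiv_form_linear [OF u] dderiv_linear [OF form_differentiable [OF u]])
  show "dderiv (\<lambda>v. \<theta> v x) u y - dderiv (\<lambda>v. \<theta> v y) u x =
      - (dderiv (\<lambda>v. \<theta> v y) u x - dderiv (\<lambda>v. \<theta> v x) u y)" for x y
    by simp
  show "riem \<Delta> u x y z + riem \<Delta> u y z x + riem \<Delta> u z x y = 0" for x y z
    by (rule W.riem_bianchi [OF u \<Delta>_sym])
qed (fact sub | (rule split LC.riem_linear1 LC.riem_linear3 LC.riem_skew12 riem_metric_skew
    W.riem_skew12 \<beta>_bilinear g_\<beta>' riem_weyl; rule u) | (rule orth pres; assumption))+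

end

section \<open>Conformal products on a manifold\<close>

lemma chart_image_open: "smooth_manifold M A \<Longrightarrow> c \<in> A \<Longrightarrow> open (chart_image c)"
  unfolding smooth_manifold_def chart_on_def by blast

lemma riemannian_metric_inner_form:
  "riemannian_metric A g \<Longrightarrow> c \<in> A \<Longrightarrow> u \<in> chart_image c \<Longrightarrow> inner_form (g c u)"
  unfolding riemannian_metric_def inner_form_def by blast

lemma one_form_linear: "one_form A \<theta> \<Longrightarrow> c \<in> A \<Longrightarrow> u \<in> chart_image c \<Longrightarrow> linear (\<theta> c u)"
  unfolding one_form_def by blast

lemma one_form_smooth: "one_form A \<theta> \<Longrightarrow> c \<in> A \<Longrightarrow> smooth_on (chart_image c) (\<lambda>u. \<theta> c u v)"
  unfolding one_form_def by blast

lemma weyl_connectionD: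
  assumes "weyl_connection A g nabla D \<theta>"
  shows "connection A D" and "one_form A \<theta>"
  using assms by (simp_all add: weyl_connection_def)

lemma cov_constant_fields: "cov \<Gamma> (\<lambda>_. x) (\<lambda>_. y) u = \<Gamma> u x y"
  by (simp add: cov_def)

lemma chart_connectionI:
  assumes "smooth_manifold M A" "connection A D" "c \<in> A"
  shows "chart_connection (chart_image c) (D c)"
proof
  show "open (chart_image c)" by (rule chart_image_open [OF assms(1,3)])
  show "bilinear (D c u)" if "u \<in> chart_image c" for u
    using assms(2,3) that unfolding connection_def by blast
  show "smooth_on (chart_image c) (\<lambda>u. D c u v w)" for v w
    using assms(2,3) unfolding connection_def by blast
qed

lemma weyl_connection_christoffel:
  assumes M: "smooth_manifold M A" and w: "weyl_connection A g nabla D \<theta>"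
    and c: "c \<in> A" "u \<in> chart_image c"
  shows "D c u x y = nabla c u x y + \<theta> c u y *\<^sub>R x + \<theta> c u x *\<^sub>R y - g c u x y *\<^sub>R sharp (g c u) (\<theta> c u)"
proof -
  have "cov (D c) X Y u = cov (nabla c) X Y u + \<theta> c u (Y u) *\<^sub>R X u + \<theta> c u (X u) *\<^sub>R Y u
      - g c u (X u) (Y u) *\<^sub>R sharp (g c u) (\<theta> c u)"
    if "smooth_on (chart_image c) X" "smooth_on (chart_image c) Y" for X Y
    using w c that chart_image_open [OF M c(1)] unfolding weyl_connection_def by blast
  from this [OF smooth_on_const smooth_on_const, of x y] show ?thesis
    by (simp only: cov_constant_fields)
qed

lemma chart_weyl_connectionI:
  assumes M: "smooth_manifold M A" and g: "riemannian_metric A g" and lc: "levi_civita A g nabla"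
    and w: "weyl_connection A g nabla D \<theta>" and c: "c \<in> A"
  shows "chart_weyl_connection (chart_image c) (nabla c) (D c) (g c) (\<theta> c)"
proof (intro chart_weyl_connection.intro chart_weyl_connection_axioms.intro)
  note N = chart_image_open [OF M c]
  show "chart_connection (chart_image c) (nabla c)" "chart_connection (chart_image c) (D c)"
    using chart_connectionI [OF M _ c] lc w by (auto simp: levi_civita_def weyl_connection_def)
  show "smooth_on (chart_image c) (\<lambda>u. g c u v w)" for v w
    using g c unfolding riemannian_metric_def by blast
  show "smooth_on (chart_image c) (\<lambda>u. \<theta> c u v)" for v
    by (rule one_form_smooth [OF weyl_connectionD(2) [OF w] c])
  fix u assume u: "u \<in> chart_image c"
  show "inner_form (g c u)" by (rule riemannian_metric_inner_form [OF g c u])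
  show "linear (\<theta> c u)" by (rule one_form_linear [OF weyl_connectionD(2) [OF w] c u])
  show "nabla c u x y = nabla c u y x" for x y
  proof -
    have "cov (nabla c) X Y u - cov (nabla c) Y X u = lie_bracket X Y u"
      if "smooth_on (chart_image c) X" "smooth_on (chart_image c) Y" for X Y
      using lc c u N that unfolding levi_civita_def torsion_free_def by blast
    from this [OF smooth_on_const smooth_on_const, of x y] show ?thesis
      by (simp add: cov_constant_fields lie_bracket_def)
  qed
  show "dderiv (\<lambda>u. g c u y z) u x = g c u (nabla c u x y) z + g c u y (nabla c u x z)" for x y z
  proof -
    have "dderiv (\<lambda>x. g c x (Y x) (Z x)) u (X u) =
        g c u (cov (nabla c) X Y u) (Z u) + g c u (Y u) (cov (nabla c) X Z u)"
      if "smooth_on (chart_image c) X" "smooth_on (chart_image c) Y" "smooth_on (chart_image c) Z" for X Y Z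
      using lc c u N that unfolding levi_civita_def metric_compatible_def by blast
    from this [OF smooth_on_const smooth_on_const smooth_on_const, of y z x] show ?thesis
      by (simp add: cov_constant_fields)
  qed
  show "D c u x y = nabla c u x y + \<theta> c u y *\<^sub>R x + \<theta> c u x *\<^sub>R y - g c u x y *\<^sub>R sharp (g c u) (\<theta> c u)" for x y
    by (rule weyl_connection_christoffel [OF M w c u])
qed

text \<open>
  In the difference \<open>D\<^sub>x x - \<nabla>\<^sub>x x = 2 \<theta>(x) x - g(x,x) \<theta>\<^sup>\<sharp>\<close>, the inner product with \<open>x\<close>
  isolates \<open>\<theta>(x) g(x,x)\<close>.
\<close>

lemma lee_form_unique:
  assumes M: "smooth_manifold M A" and g: "riemannian_metric A g"
    and w: "weyl_connection A g nabla D \<theta>" and w': "weyl_connection A g nabla D \<theta>'"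
    and c: "c \<in> A" "u \<in> chart_image c"
  shows "\<theta> c u x = \<theta>' c u x"
proof -
  have lin: "linear (\<theta> c u)" "linear (\<theta>' c u)"
    using one_form_linear [OF _ c] weyl_connectionD(2) [OF w] weyl_connectionD(2) [OF w'] by blast+
  show ?thesis
proof (cases "x = 0")
  case True
  then show ?thesis using lin by (simp add: linear_0)
next
  case False
  interpret inner_form "g c u" by (rule riemannian_metric_inner_form [OF g c])
  have "g c u (D c u x x - nabla c u x x) x = \<theta> c u x * g c u x x"
    if "weyl_connection A g nabla D \<theta>" "linear (\<theta> c u)" for \<theta>
    unfolding weyl_connection_christoffel [OF M that(1) c] by (simp add: G_simps G_sharp [OF that(2)])
  from this [OF w lin(1)] this [OF w' lin(2)] show ?thesis
    using pos [OF False] by simp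
qed
qed

text \<open>
  Closedness of \<open>D\<close> asks for some closed Lee form; by uniqueness it is the given one.
\<close>

lemma closed_weyl_connection_iff:
  assumes M: "smooth_manifold M A" and g: "riemannian_metric A g"
    and w: "weyl_connection A g nabla D \<theta>"
  shows "closed_weyl_connection A g nabla D \<longleftrightarrow> closed_form A \<theta>"
proof
  assume "closed_weyl_connection A g nabla D"
  then obtain \<theta>' where w': "weyl_connection A g nabla D \<theta>'" and cl: "closed_form A \<theta>'"
    unfolding closed_weyl_connection_def by blast
  have "ext_deriv \<theta> c u x y = ext_deriv \<theta>' c u x y" if c: "c \<in> A" "u \<in> chart_image c" for c u x y
  proof -
    note N = chart_image_open [OF M c(1)]
    have "(\<lambda>v. \<theta> c v z) differentiable at u" for z
      by (rule smooth_on_differentiable_at [OF one_form_smooth [OF weyl_connectionD(2) [OF w] c(1)] N c(2)])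
    then have "dderiv (\<lambda>v. \<theta> c v z) u a = dderiv (\<lambda>v. \<theta>' c v z) u a" for z a
      using N c(2) lee_form_unique [OF M g w w' c(1)] by (rule dderiv_cong)
    then show ?thesis by (simp add: ext_deriv_def)
  qed
  then show "closed_form A \<theta>" using cl by (simp add: closed_form_def)
qed (use w in \<open>auto simp: closed_weyl_connection_def\<close>)

lemma splitting_involution_eq:
  assumes sub: "subspace (T1 c u)" "subspace (T2 c u)" and int: "T1 c u \<inter> T2 c u = {0}"
    and v: "v1 \<in> T1 c u" "v2 \<in> T2 c u"
  shows "splitting_involution T1 T2 c u (v1 + v2) = v1 - v2"
  unfolding splitting_involution_def
proof (rule the_equality)
  fix w assume "\<exists>w1\<in>T1 c u. \<exists>w2\<in>T2 c u. v1 + v2 = w1 + w2 \<and> w = w1 - w2"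
  then obtain w1 w2 where w: "w1 \<in> T1 c u" "w2 \<in> T2 c u" "v1 + v2 = w1 + w2" "w = w1 - w2" by blast
  have "v1 - w1 = w2 - v2" using w(3) by (simp add: algebra_simps)
  moreover have "v1 - w1 \<in> T1 c u" "w2 - v2 \<in> T2 c u" using sub v w by (auto intro: subspace_diff)
  ultimately have "w2 - v2 \<in> T1 c u \<inter> T2 c u" by simp
  then have "w2 = v2" unfolding int by simp
  then show "w = v1 - v2" using w(3,4) by simp
qed (use v in blast)

lemma splitting_involution_linear:
  fixes T1 T2 :: "('a, 'v::euclidean_space) dist"
  assumes sub: "subspace (T1 c u)" "subspace (T2 c u)" and int: "T1 c u \<inter> T2 c u = {0}"
    and split: "\<And>v. \<exists>v1\<in>T1 c u. \<exists>v2\<in>T2 c u. v = v1 + v2"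
  shows "linear (splitting_involution T1 T2 c u)"
proof (rule linearI)
  note S = splitting_involution_eq [where ?T1.0 = T1 and ?T2.0 = T2 and c = c and u = u, OF sub int]
  fix v w :: 'v and r :: real
  obtain v1 v2 w1 w2 where v: "v1 \<in> T1 c u" "v2 \<in> T2 c u" "v = v1 + v2"
    and w: "w1 \<in> T1 c u" "w2 \<in> T2 c u" "w = w1 + w2" using split by metis
  have "v + w = (v1 + w1) + (v2 + w2)" using v w by simp
  then have "splitting_involution T1 T2 c u (v + w) = (v1 + w1) - (v2 + w2)"
    by (simp only: S [OF subspace_add [OF sub(1) v(1) w(1)] subspace_add [OF sub(2) v(2) w(2)]])
  then show "splitting_involution T1 T2 c u (v + w)
      = splitting_involution T1 T2 c u v + splitting_involution T1 T2 c u w"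
    using S [OF v(1,2)] S [OF w(1,2)] v(3) w(3) by simp
  have "r *\<^sub>R v = r *\<^sub>R v1 + r *\<^sub>R v2" using v by (simp add: scaleR_add_right)
  then have "splitting_involution T1 T2 c u (r *\<^sub>R v) = r *\<^sub>R v1 - r *\<^sub>R v2"
    by (simp only: S [OF subspace_scale [OF sub(1) v(1)] subspace_scale [OF sub(2) v(2)]])
  then show "splitting_involution T1 T2 c u (r *\<^sub>R v) = r *\<^sub>R splitting_involution T1 T2 c u v"
    using S [OF v(1,2)] v(3) by (simp add: scaleR_diff_right)
qed

lemma distribution_fibre:
  assumes "distribution A r T" "c \<in> A" "u \<in> chart_image c"
  shows "subspace (T c u)" and "dim (T c u) = r"
proof -
  have "\<forall>c\<in>A. \<forall>u\<in>chart_image c. subspace (T c u) \<and> dim (T c u) = r"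
    using assms(1) unfolding distribution_def by (elim conjE)
  then show "subspace (T c u)" "dim (T c u) = r" using assms(2,3) by blast+
qed

lemma weyl_connection_curvature_preserves:
  assumes M: "smooth_manifold M A" and D: "connection A D" and T: "distribution A r T"
    and pres: "preserves_distribution A D T" and c: "c \<in> A" "u \<in> chart_image c" and z: "z \<in> T c u"
  shows "riem (D c) u x y z \<in> T c u"
proof -
  interpret chart_connection "chart_image c" "D c" by (rule chart_connectionI [OF M D c(1)])
  obtain N F where F: "open N" "u \<in> N" "N \<subseteq> chart_image c" "\<forall>i<r. smooth_on N (F i)"
    "\<forall>x\<in>N. T c x = span ((\<lambda>i. F i x) ` {..<r})"
  proof -
    have "\<forall>c\<in>A. \<forall>u\<in>chart_image c. \<exists>N F. open N \<and> u \<in> N \<and> N \<subseteq> chart_image c \<and>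
        (\<forall>i<r. smooth_on N (F i)) \<and> (\<forall>x\<in>N. T c x = span ((\<lambda>i. F i x) ` {..<r}))"
      using T unfolding distribution_def by (elim conjE)
    from bspec [OF bspec [OF this c(1)] c(2)] show thesis using that by (elim exE conjE)
  qed
  show ?thesis
  proof (rule riem_preserves [where T = "T c" and F = F and r = r, OF _ _ F(1,3,2) _ _ z])
    have "\<forall>N X Y. open N \<and> N \<subseteq> chart_image c \<and> smooth_on N X \<and> smooth_on N Y \<and>
        (\<forall>u\<in>N. Y u \<in> T c u) \<longrightarrow> (\<forall>u\<in>N. cov (D c) X Y u \<in> T c u)"
      using pres c(1) unfolding preserves_distribution_def by (rule bspec)
    then show "cov (D c) X Y u \<in> T c u" if "open N'" "N' \<subseteq> chart_image c" "smooth_on N' X" "smooth_on N' Y"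
      "\<forall>u\<in>N'. Y u \<in> T c u" "u \<in> N'" for N' X Y u
      using that by simp
    show "subspace (T c u)" by (rule distribution_fibre(1) [OF T c])
  qed (use F in auto)
qed

text \<open>
  At a point of a chart, the two curvatures and \<open>d\<theta>\<close> form a \<open>conformal_product_curvature\<close>, so the
  equivalence is the algebraic one.
\<close>

lemma pointwise_equivalence:
  assumes M: "smooth_manifold M A" and g: "riemannian_metric A g" and lc: "levi_civita A g nabla"
    and cp: "conformal_product A g nabla p q T1 T2 D \<theta>" and pq: "p \<ge> 2" "q \<ge> 2"
    and c: "c \<in> A" "u \<in> chart_image c"
  defines "S \<equiv> splitting_involution T1 T2"
  defines "K \<equiv> weyl_contraction g nabla S c u"
  shows "(\<forall>x y. ext_deriv \<theta> c u x y = 0) \<longleftrightarrow> K ` T1 c u \<subseteq> T1 c u \<and> K ` T2 c u \<subseteq> T2 c u"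
    and "(\<forall>x y. ext_deriv \<theta> c u x y = 0) \<longleftrightarrow> (\<forall>x. K (S c u x) = S c u (K x))"
proof -
  have w: "weyl_connection A g nabla D \<theta>" and T: "distribution A p T1" "distribution A q T2"
    and pres: "preserves_distribution A D T1" "preserves_distribution A D T2"
    and os: "orthogonal_splitting A g T1 T2"
    using cp by (simp_all add: conformal_product_def)
  have D: "connection A D" using w by (simp add: weyl_connection_def)
  have sub: "subspace (T1 c u)" "subspace (T2 c u)" and dims: "dim (T1 c u) = p" "dim (T2 c u) = q"
    using distribution_fibre [OF T(1) c] distribution_fibre [OF T(2) c] by simp_all
  have int: "T1 c u \<inter> T2 c u = {0}" and split: "\<exists>v1\<in>T1 c u. \<exists>v2\<in>T2 c u. v = v1 + v2"
    and orth: "v1 \<in> T1 c u \<Longrightarrow> v2 \<in> T2 c u \<Longrightarrow> g c u v1 v2 = 0" for v v1 v2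
    using os c unfolding orthogonal_splitting_def by blast+
  interpret W: chart_weyl_connection "chart_image c" "nabla c" "D c" "g c" "\<theta> c"
    by (rule chart_weyl_connectionI [OF M g lc w c(1)])
  interpret C: conformal_product_curvature "g c u" "T1 c u" "T2 c u" "riem (nabla c) u" "riem (D c) u"
    "ext_deriv \<theta> c u" "W.\<beta> u" "W.\<beta>' u"
    unfolding ext_deriv_def
    by (intro W.conformal_product_curvatureI c(2) sub split orth
        weyl_connection_curvature_preserves [OF M D T(1) pres(1) c]
        weyl_connection_curvature_preserves [OF M D T(2) pres(2) c])
  let ?E = "SOME E. orthonormal_basis (g c u) E" and ?s = "scalar_curvature (g c u) (nabla c) u"
  have E: "orthonormal_basis (g c u) ?E" using C.orthonormal_basis_exists by (rule someI_ex)
  have "weyl_tensor g nabla c u x y z = C.weyl ?s x y z" for x y z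
  proof -
    have "ricci (nabla c) u = C.ric" by (simp add: fun_eq_iff ricci_def C.ric_def)
    then show ?thesis by (simp add: weyl_tensor_def C.weyl_def ricci_endo_def Let_def)
  qed
  then have K: "K = (\<lambda>x. \<Sum>e\<in>?E. C.weyl ?s x e (S c u e))"
    by (simp add: K_def weyl_contraction_def fun_eq_iff)
  have S: "linear (S c u)" "\<And>v. v \<in> T1 c u \<Longrightarrow> S c u v = v" "\<And>v. v \<in> T2 c u \<Longrightarrow> S c u v = - v"
    using splitting_involution_linear [where ?T1.0 = T1 and ?T2.0 = T2 and c = c and u = u, OF sub int split]
      splitting_involution_eq [where ?T1.0 = T1 and ?T2.0 = T2 and c = c and u = u, OF sub int, of _ 0]
      splitting_involution_eq [where ?T1.0 = T1 and ?T2.0 = T2 and c = c and u = u, OF sub int, of 0]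
      subspace_0 [OF sub(1)] subspace_0 [OF sub(2)]
    by (simp_all add: S_def)
  have ranks: "2 \<le> dim (T1 c u)" "2 \<le> dim (T2 c u)" using dims pq by simp_all
  show "(\<forall>x y. ext_deriv \<theta> c u x y = 0) \<longleftrightarrow> K ` T1 c u \<subseteq> T1 c u \<and> K ` T2 c u \<subseteq> T2 c u"
    unfolding K by (rule C.F_zero_iff_contraction_splits(1) [OF E S ranks])
  show "(\<forall>x y. ext_deriv \<theta> c u x y = 0) \<longleftrightarrow> (\<forall>x. K (S c u x) = S c u (K x))"
    unfolding K by (rule C.F_zero_iff_contraction_splits(2) [OF E S ranks])
qed

theorem corollary2p12:
  fixes M :: "'a topology"
    and A :: "('a, 'v::euclidean_space) chart set"
    and g :: "('a, 'v) metric"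
    and nabla D :: "('a, 'v) conn"
    and \<theta> :: "('a, 'v) oneform"
    and T1 T2 :: "('a, 'v) dist"
    and p q :: nat
  assumes "smooth_manifold M A"
    and "riemannian_metric A g"
    and "levi_civita A g nabla"
    and "conformal_product A g nabla p q T1 T2 D \<theta>"
    and "p \<ge> 2" and "q \<ge> 2"
  shows "let S = splitting_involution T1 T2; K = weyl_contraction g nabla S in
    (closed_weyl_connection A g nabla D \<longleftrightarrow> closed_form A \<theta>) \<and>
    (closed_form A \<theta> \<longleftrightarrow> vanishing_endo A (commutator K S)) \<and>
    (closed_weyl_connection A g nabla D \<longleftrightarrow> endo_preserves A K T1 \<and> endo_preserves A K T2)"
proof -
  let ?S = "splitting_involution T1 T2" and ?K = "weyl_contraction g nabla (splitting_involution T1 T2)"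
  note pt = pointwise_equivalence [OF assms]
  have "weyl_connection A g nabla D \<theta>" using assms(4) by (simp add: conformal_product_def)
  then have closed: "closed_weyl_connection A g nabla D \<longleftrightarrow> closed_form A \<theta>"
    by (rule closed_weyl_connection_iff [OF assms(1,2)])
  have "(\<forall>v. commutator ?K ?S c u v = 0) \<longleftrightarrow> (\<forall>v w. ext_deriv \<theta> c u v w = 0)"
    if "c \<in> A" "u \<in> chart_image c" for c u
    unfolding commutator_def right_minus_eq by (rule pt(2) [OF that, symmetric])
  then have "closed_form A \<theta> \<longleftrightarrow> vanishing_endo A (commutator ?K ?S)"
    unfolding closed_form_def vanishing_endo_def by (simp cong: ball_cong)
  moreover have "closed_form A \<theta> \<longleftrightarrow> endo_preserves A ?K T1 \<and> endo_preserves A ?K T2"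
    using pt(1) unfolding closed_form_def endo_preserves_def image_subset_iff by blast
  ultimately show ?thesis using closed by (simp add: Let_def)
qed

end
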